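(* Let $D=(V,A)$ be a 2-strong semicomplete multipartite digraph with distinct vertices $x,y,z\in V$ such that neither $x$ nor $y$ is contained in a 2-cycle and both $D-x$ and $D-y$ are 2-strong. If $D-\{x,y,z\}$ is not strong and $\chi(D-\{x,y,z\})\geq 4$, then $D$ contains an $(x,y)$-quasi-Hamiltonian path.
   Context: All digraphs are finite and simple: no loops and no parallel arcs, but both arcs $vw$ and $wv$ may be present (they then form a 2-cycle). A semicomplete multipartite digraph is a digraph $D$ whose vertex set is partitioned into color classes $V_1,\dots,V_c$ such that, for every pair of distinct vertices, there is at least one arc between them if and only if they lie in different color classes; this partition is unique. The chromatic number $\chi(D)$ is that of the underlying undirected graph; for a semicomplete multipartite digraph it equals the number of color classes. An $(x,y)$-path is a directed path starting at $x$ and ending at $y$. An $(x,y)$-quasi-Hamiltonian path in $D$ is an $(x,y)$-path containing at least one vertex from each color class of $D$. A digraph is strong if it contains an $(u,v)$-path for every pair of distinct vertices $u,v$. A digraph is $k$-strong if it has at least $k+1$ vertices, is strong, and remains strong after removing any set of at most $k-1$ vertices. $D-x$ and $D-S$ denote deletion of a vertex $x$ or of a vertex set $S$. *)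

theory Defs
  imports "Graph_Theory.Graph_Theory" "HOL-Library.Disjoint_Sets"
begin

abbreviation del_verts :: "('a,'b) pre_digraph \<Rightarrow> 'a set \<Rightarrow> ('a,'b) pre_digraph" where
  "del_verts D S \<equiv> D \<restriction> (verts D - S)"

text \<open>
  \<^const>\<open>strongly_connected\<close> excludes the null digraph and speaks of reachability. On nonempty
  digraphs this is the existence of a directed path between any two distinct vertices:
\<close>

lemma strongly_connected_iff_vpath:
  assumes "wf_digraph D"
  shows "strongly_connected D \<longleftrightarrow> verts D \<noteq> {} \<and>
    (\<forall>u\<in>verts D. \<forall>v\<in>verts D. u \<noteq> v \<longrightarrow> (\<exists>p. vpath p D \<and> hd p = u \<and> last p = v))"
proof -
  interpret wf_digraph D by (fact assms)
  have "u \<rightarrow>\<^sup>*\<^bsub>D\<^esub> u" if "u \<in> verts D" for u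
    using that by (rule reachable_refl)
  then show ?thesis
    unfolding strongly_connected_def reachable_vpath_conv[symmetric] by metis
qed

text \<open>
  The null digraph never occurs among the digraphs tested below: at least \<open>k + 1\<close> vertices are
  present and at most \<open>k - 1\<close> of them are deleted. The cardinality bound also forces
  \<^term>\<open>verts D\<close> to be finite.
\<close>

definition k_strong :: "nat \<Rightarrow> ('a,'b) pre_digraph \<Rightarrow> bool" where
  "k_strong k D \<longleftrightarrow>
     k + 1 \<le> card (verts D) \<and> strongly_connected D \<and>
     (\<forall>S \<subseteq> verts D. card S \<le> k - 1 \<longrightarrow> strongly_connected (del_verts D S))"

definition in_2cycle :: "('a,'b) pre_digraph \<Rightarrow> 'a \<Rightarrow> bool" where
  "in_2cycle D v \<longleftrightarrow> (\<exists>w. w \<noteq> v \<and> v \<rightarrow>\<^bsub>D\<^esub> w \<and> w \<rightarrow>\<^bsub>D\<^esub> v)"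

text \<open>
  \<^const>\<open>mk_symmetric\<close> is the underlying undirected graph, given as a symmetric digraph.
\<close>

definition colorable :: "('a,'b) pre_digraph \<Rightarrow> nat \<Rightarrow> bool" where
  "colorable D k \<longleftrightarrow> (\<exists>f :: 'a \<Rightarrow> nat.
     (\<forall>v\<in>verts D. f v < k) \<and> (\<forall>(u,v) \<in> parcs (mk_symmetric D). f u \<noteq> f v))"

text \<open>Meaningful for finite loop-free digraphs, which are \<open>k\<close>-colorable for some \<open>k\<close>.\<close>

definition chromatic_number :: "('a,'b) pre_digraph \<Rightarrow> nat" where
  "chromatic_number D = (LEAST k. colorable D k)"

text \<open>
  \<^locale>\<open>digraph\<close> means finite, without loops and without parallel arcs. The color classes \<open>\<C>\<close> are
  carried as a parameter; by the lemma \<open>color_classes_unique\<close> below they are determined by \<open>D\<close>.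
\<close>

locale semicomplete_multipartite = digraph D
  for D :: "('a,'b) pre_digraph" and \<C> :: "'a set set" +
  assumes partition: "partition_on (verts D) \<C>"
    and adjacent_iff: "\<lbrakk>u \<in> verts D; v \<in> verts D; u \<noteq> v\<rbrakk> \<Longrightarrow>
      (u \<rightarrow>\<^bsub>D\<^esub> v \<or> v \<rightarrow>\<^bsub>D\<^esub> u) \<longleftrightarrow> \<not> (\<exists>C\<in>\<C>. u \<in> C \<and> v \<in> C)"

definition quasi_hamiltonian_path ::
  "('a,'b) pre_digraph \<Rightarrow> 'a set set \<Rightarrow> 'a \<Rightarrow> 'a vwalk \<Rightarrow> 'a \<Rightarrow> bool" where
  "quasi_hamiltonian_path D \<C> x p y \<longleftrightarrow>
     vpath p D \<and> hd p = x \<and> last p = y \<and> (\<forall>C\<in>\<C>. set p \<inter> C \<noteq> {})"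

lemma (in semicomplete_multipartite) color_class_eq:
  assumes "C \<in> \<C>" "u \<in> C"
  shows "C = {v \<in> verts D. v = u \<or> \<not> (u \<rightarrow>\<^bsub>D\<^esub> v \<or> v \<rightarrow>\<^bsub>D\<^esub> u)}"
proof -
  have in_verts: "w \<in> verts D" if "w \<in> C" for w
    using that assms(1) partition_onD1[OF partition] by auto
  have same: "C' = C" if "C' \<in> \<C>" "u \<in> C'" for C'
    using disjointD[OF partition_onD2[OF partition] that(1) assms(1)] that(2) assms(2) by auto
  have "v \<in> C \<longleftrightarrow> v \<in> verts D \<and> (v = u \<or> \<not> (u \<rightarrow>\<^bsub>D\<^esub> v \<or> v \<rightarrow>\<^bsub>D\<^esub> u))" for v
  proof (cases "v \<in> verts D \<and> v \<noteq> u")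
    case True
    then have "(u \<rightarrow>\<^bsub>D\<^esub> v \<or> v \<rightarrow>\<^bsub>D\<^esub> u) \<longleftrightarrow> \<not> (\<exists>C\<in>\<C>. u \<in> C \<and> v \<in> C)"
      by (intro adjacent_iff) (auto intro: in_verts assms)
    moreover have "(\<exists>C\<in>\<C>. u \<in> C \<and> v \<in> C) \<longleftrightarrow> v \<in> C"
      using same assms by metis
    ultimately show ?thesis using True by metis
  next
    case False
    then show ?thesis using in_verts assms(2) by metis
  qed
  then show ?thesis by auto
qed

lemma color_classes_subset:
  assumes "semicomplete_multipartite D \<C>" "semicomplete_multipartite D \<C>'"
  shows "\<C> \<subseteq> \<C>'"
proof
  fix C assume C: "C \<in> \<C>"
  interpret A: semicomplete_multipartite D \<C> by (fact assms(1))
  interpret B: semicomplete_multipartite D \<C>' by (fact assms(2))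
  have "C \<noteq> {}" using C partition_onD3[OF A.partition] by metis
  then obtain u where u: "u \<in> C" by auto
  then have "u \<in> \<Union>\<C>'"
    using C partition_onD1[OF A.partition] partition_onD1[OF B.partition] by auto
  then obtain C' where C': "C' \<in> \<C>'" "u \<in> C'" by auto
  show "C \<in> \<C>'"
    using A.color_class_eq[OF C u] B.color_class_eq[OF C'] C'(1) by simp
qed

lemma color_classes_unique:
  assumes "semicomplete_multipartite D \<C>" "semicomplete_multipartite D \<C>'"
  shows "\<C> = \<C>'"
  using color_classes_subset[OF assms] color_classes_subset[OF assms(2,1)] by (rule equalityI)

end

theory Submission
  imports Defs
begin

text \<open>
  Write \<open>H = V - {x, y, z}\<close>. The path is found in two stages: a short path that meets the right
  places is constructed, and it is then enlarged, keeping its ends, until it meets every colour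
  class.

  \<^bold>\<open>Enlarging.\<close> Let \<open>v\<close> have a colour that is missing on a path \<open>p\<close>. Then \<open>v\<close> is adjacent to every
  vertex of \<open>p\<close>. If \<open>v\<close> sends no arc to the first vertex of \<open>p\<close> and fits between no two consecutive
  vertices, then every vertex of \<open>p\<close> sends an arc to \<open>v\<close>; a way back from \<open>v\<close> to \<open>p\<close> that
  avoids the first vertex is then a detour which can be spliced in (\<open>insert_into_dipath\<close>). There is a
  mirror image at the last vertex. Suitable first and last vertices are found at the ends of \<open>H\<close>:
  as \<open>H\<close> is not strong, it has a strong component \<open>A\<close> that no arc of \<open>H\<close> enters and a strong component
  \<open>B\<close> that no arc of \<open>H\<close> leaves. Since \<open>D - {y, z}\<close>, \<open>D - {x, y}\<close> and \<open>D - {x, z}\<close> are strong, each of \<open>x\<close>,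
  \<open>y\<close>, \<open>z\<close> sends an arc into \<open>A\<close> and receives one from \<open>B\<close>.

  \<^bold>\<open>The vertex\<close> \<open>z\<close>. If another vertex shares its colour, then either \<open>x\<close> or \<open>y\<close> does, or enlarging by
  vertices of \<open>H\<close> meets that class. Otherwise \<open>z\<close> must lie on the path that is enlarged, and \<open>z\<close> is
  adjacent to all other vertices. Then \<open>dipath_through\<close> applies, a statement about arbitrary
  digraphs: if \<open>s\<close> sends no arc to \<open>t\<close>, no single vertex separates \<open>s\<close> from \<open>t\<close>, and \<open>z\<close> is adjacent to
  the out-neighbours of \<open>s\<close>, then, apart from two obviously necessary conditions, nothing more is
  needed for an \<open>(s,t)\<close>-path through \<open>z\<close>.

  \<^bold>\<open>A trivial end.\<close> If \<open>A = {a}\<close>, then \<open>y\<close> sends an arc to \<open>a\<close> and lies on no 2-cycle, so \<open>a\<close> sends no arc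
  to \<open>y\<close>. As \<open>D - x\<close> is 2-strong, it has an \<open>(a,y)\<close>-path, through \<open>z\<close> if required; it can be
  enlarged because no vertex of \<open>H\<close> sends an arc to \<open>a\<close>, and it is preceded by \<open>x\<close>. The case of a single vertex in \<open>B\<close>
  follows by reversing all arcs and exchanging \<open>x\<close> and \<open>y\<close>, which preserves all hypotheses.

  \<^bold>\<open>Nontrivial ends.\<close> Here a path from some \<open>a \<in> A\<close> with \<open>x \<rightarrow> a\<close> to some \<open>b \<in> B\<close> with \<open>b \<rightarrow> y\<close> can be enlarged
  (\<open>spanning_from_end_path\<close>): vertices outside \<open>A\<close> are handled from its start, vertices of \<open>A\<close> from its
  end. It remains to lead such a path through \<open>z\<close>, again by \<open>dipath_through\<close>. Its start is \<open>x\<close>, or the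
  vertex \<open>a\<close> if \<open>a\<close> is the only out-neighbour of \<open>x\<close> in \<open>A\<close>, and likewise for its end. Since \<open>A\<close> and \<open>B\<close>
  contain two colours each, deleting one vertex leaves a path from each remaining vertex of \<open>A\<close> to
  each remaining vertex of \<open>B\<close>. The only trouble arises when both \<open>a\<close> and \<open>b\<close> are forced and the arc
  from \<open>a\<close> to \<open>b\<close>, which \<open>dipath_through\<close> excludes, belongs to every path that avoids some vertex \<open>w\<close>.
  That leaves so little freedom that, with a fourth colour at hand, a path can be written down
  (\<open>z_path_of_cut_arc\<close>).
\<close>

section \<open>Paths\<close>

definition dipath :: "('a \<Rightarrow> 'a \<Rightarrow> bool) \<Rightarrow> 'a \<Rightarrow> 'a list \<Rightarrow> 'a \<Rightarrow> bool" where
  "dipath R u p v \<longleftrightarrow> p \<noteq> [] \<and> hd p = u \<and> last p = v \<and> distinct p \<and> successively R p"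

definition connects :: "('a \<Rightarrow> 'a \<Rightarrow> bool) \<Rightarrow> 'a set \<Rightarrow> 'a \<Rightarrow> 'a \<Rightarrow> bool" where
  "connects R W u v \<longleftrightarrow> (\<exists>p. dipath R u p v \<and> set p \<subseteq> W)"

lemma connectsI: "dipath R u p v \<Longrightarrow> set p \<subseteq> W \<Longrightarrow> connects R W u v"
  unfolding connects_def by blast

lemma connectsE:
  assumes "connects R W u v"
  obtains p where "dipath R u p v" "set p \<subseteq> W"
  using assms unfolding connects_def by blast

lemma dipath_single: "dipath R u [u] u"
  unfolding dipath_def by simp

lemma dipath_ends: "dipath R u p v \<Longrightarrow> u \<in> set p \<and> v \<in> set p"
  unfolding dipath_def by auto

lemma dipath_append:
  "dipath R u p v \<Longrightarrow> R v w \<Longrightarrow> dipath R w q t \<Longrightarrow> set p \<inter> set q = {} \<Longrightarrow> dipath R u (p @ q) t"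
  unfolding dipath_def by (auto simp: successively_append_iff)

lemma dipath_Cons:
  "R u v \<Longrightarrow> dipath R v p t \<Longrightarrow> u \<notin> set p \<Longrightarrow> dipath R u (u # p) t"
  using dipath_append[OF dipath_single, of R u v p t] by simp

lemma dipath_snoc:
  "dipath R u p v \<Longrightarrow> R v t \<Longrightarrow> t \<notin> set p \<Longrightarrow> dipath R u (p @ [t]) t"
  using dipath_append[OF _ _ dipath_single, of R u p v t] by simp

lemma dipath_split:
  assumes "dipath R u (p @ m # q) v"
  shows "dipath R u (p @ [m]) m" "dipath R m (m # q) v"
  using assms unfolding dipath_def
  by (auto simp: successively_append_iff successively_Cons hd_append split: if_splits)

lemma dipath_join:
  assumes "dipath R u (p @ [m]) m" "dipath R m (m # q) v" "set p \<inter> set q = {}"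
  shows "dipath R u (p @ m # q) v"
  using assms unfolding dipath_def
  by (auto simp: successively_append_iff successively_Cons hd_append split: if_splits)

lemma dipath_tl:
  assumes "dipath R u p v" "u \<noteq> v"
  obtains w q where "p = u # q" "R u w" "dipath R w q v" "u \<notin> set q"
proof -
  obtain q where q: "p = u # q"
    using assms(1) unfolding dipath_def by (cases p) auto
  then have "q \<noteq> []" using assms unfolding dipath_def by auto
  then have "R u (hd q)" "dipath R (hd q) q v" "u \<notin> set q"
    using assms(1) q unfolding dipath_def by (auto simp: successively_Cons)
  then show thesis using that q by blast
qed

lemma dipath_butlast:
  assumes "dipath R u p v" "u \<noteq> v"
  obtains w q where "p = q @ [v]" "R w v" "dipath R u q w" "v \<notin> set q"
proof -
  obtain q where q: "p = q @ [v]"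
    using assms(1) unfolding dipath_def by (cases p rule: rev_cases) auto
  then have "q \<noteq> []" using assms unfolding dipath_def by auto
  then have "R (last q) v" "dipath R u q (last q)" "v \<notin> set q"
    using assms(1) q unfolding dipath_def by (auto simp: successively_append_iff)
  then show thesis using that q by blast
qed

lemma dipath_mono:
  assumes "dipath R u p v" "\<And>a b. a \<in> set p \<Longrightarrow> b \<in> set p \<Longrightarrow> R a b \<Longrightarrow> S a b"
  shows "dipath S u p v"
  using assms unfolding dipath_def by (auto intro: successively_mono)

lemma dipath_rev: "dipath (\<lambda>a b. R b a) v (rev p) u \<longleftrightarrow> dipath R u p v"
  unfolding dipath_def by (auto simp: hd_rev last_rev)

lemma connects_rev: "connects (\<lambda>a b. R b a) W v u \<longleftrightarrow> connects R W u v"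
proof -
  have one: "connects (\<lambda>a b. S b a) W s t" if "connects S W t s" for S s t
    using that unfolding connects_def by (metis dipath_rev set_rev)
  from one[of R u v] one[of "\<lambda>a b. R b a" v u] show ?thesis by auto
qed

lemma connects_refl: "u \<in> W \<Longrightarrow> connects R W u u"
  by (rule connectsI[OF dipath_single]) simp

lemma connects_ends: "connects R W u v \<Longrightarrow> u \<in> W \<and> v \<in> W"
  unfolding connects_def using dipath_ends by fast

lemma connects_step:
  assumes "R u v" "u \<in> W" "connects R W v t"
  shows "connects R W u t"
proof -
  obtain p where p: "dipath R v p t" "set p \<subseteq> W" using assms(3) by (rule connectsE)
  show ?thesis
  proof (cases "u \<in> set p")
    case True
    then obtain p1 p2 where "p = p1 @ u # p2" by (metis split_list)
    then have "dipath R u (u # p2) t" "set (u # p2) \<subseteq> W" using p dipath_split(2) by auto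
    then show ?thesis by (rule connectsI)
  next
    case False
    from dipath_Cons[OF assms(1) p(1) this] show ?thesis
      by (rule connectsI) (use p(2) assms(2) in auto)
  qed
qed

lemma connects_arc: "R u v \<Longrightarrow> u \<in> W \<Longrightarrow> v \<in> W \<Longrightarrow> connects R W u v"
  by (rule connects_step[OF _ _ connects_refl])

lemma connects_trans:
  assumes "connects R W u v" "connects R W v t"
  shows "connects R W u t"
proof -
  have "connects R W u t" if "dipath R u p v" "set p \<subseteq> W" for p
    using that
  proof (induction p arbitrary: u)
    case Nil
    then show ?case by (simp add: dipath_def)
  next
    case (Cons a p)
    show ?case
    proof (cases "u = v")
      case True
      then show ?thesis using assms(2) by simp
    next
      case False
      from dipath_tl[OF Cons.prems(1) this] obtain w q
        where "a # p = u # q" "R u w" "dipath R w q v" by blast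
      then have "connects R W w t" "R u w" "u \<in> W" using Cons by auto
      then show ?thesis using connects_step by metis
    qed
  qed
  then show ?thesis using assms(1) unfolding connects_def[of R W u v] by blast
qed

lemma connects_mono:
  assumes "connects R W u v" "W \<subseteq> W'"
    and "\<And>a b. a \<in> W \<Longrightarrow> b \<in> W \<Longrightarrow> R a b \<Longrightarrow> S a b"
  shows "connects S W' u v"
proof -
  obtain p where p: "dipath R u p v" "set p \<subseteq> W" using assms(1) by (rule connectsE)
  have "dipath S u p v" using dipath_mono[OF p(1)] p(2) assms(3) by blast
  then show ?thesis by (rule connectsI) (use p(2) assms(2) in blast)
qed

lemma connects_subset: "connects R W u v \<Longrightarrow> W \<subseteq> W' \<Longrightarrow> connects R W' u v"
  by (rule connects_mono)

text \<open>
  A path that ends in \<open>A\<close> but starts outside crosses the border; this turns strong connectivity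
  into the existence of arcs.
\<close>

lemma connects_enters:
  assumes "connects R W u v" "u \<notin> A" "v \<in> A"
  obtains a b where "R a b" "a \<in> W - A" "b \<in> W \<inter> A"
proof -
  have "\<exists>a b. R a b \<and> a \<in> W - A \<and> b \<in> W \<inter> A" if "dipath R u p v" "set p \<subseteq> W" "u \<notin> A" for p
    using that
  proof (induction p arbitrary: u)
    case Nil
    then show ?case by (simp add: dipath_def)
  next
    case (Cons a p)
    have "u \<noteq> v" using Cons.prems(3) assms(3) by blast
    from dipath_tl[OF Cons.prems(1) this] obtain w q
      where w: "a # p = u # q" "R u w" "dipath R w q v" by blast
    have "u \<in> W" "w \<in> W" using w Cons.prems(2) dipath_ends by fastforce+
    show ?case
    proof (cases "w \<in> A")
      case True
      then show ?thesis using w \<open>u \<in> W\<close> \<open>w \<in> W\<close> Cons.prems(3) by blast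
    next
      case False
      then show ?thesis using Cons.IH[of w] w Cons.prems(2) by auto
    qed
  qed
  then show thesis using assms(1,2) that unfolding connects_def by blast
qed

section \<open>Inserting a vertex into a path\<close>

lemma dipath_detour:
  assumes p: "dipath R s (p1 @ a # b # p2) t"
    and q: "dipath R v q w" "R a v" "R w b" "set q \<inter> set (p1 @ a # b # p2) = {}"
  shows "dipath R s (p1 @ a # q @ b # p2) t"
proof -
  have 1: "dipath R s (p1 @ [a]) a" "dipath R a (a # b # p2) t"
    using dipath_split[OF p] by auto
  have "dipath R b (b # p2) t" using dipath_split(2)[of R s "p1 @ [a]" b p2 t] p by simp
  then have "dipath R v (q @ b # p2) t" using dipath_append q(1,3,4) by fastforce
  then have "dipath R s ((p1 @ [a]) @ (q @ b # p2)) t"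
    by (rule dipath_append[OF 1(1) q(2)]) (use p q(4) in \<open>auto simp: dipath_def\<close>)
  then show ?thesis by simp
qed

text \<open>
  If \<open>v\<close> fits nowhere, then arcs into \<open>v\<close> propagate along \<open>p\<close>: from \<open>a \<rightarrow> v\<close> and not \<open>v \<rightarrow> b\<close> follows
  \<open>b \<rightarrow> v\<close>. As the first vertex \<open>s\<close> sends an arc to \<open>v\<close>, all of \<open>p\<close> does. A path from \<open>v\<close> to \<open>t\<close> avoiding \<open>s\<close>
  first meets \<open>p\<close> in a vertex \<open>m\<close> other than \<open>s\<close>, so its part before \<open>m\<close> can be inserted between \<open>m\<close> and
  the predecessor of \<open>m\<close> on \<open>p\<close>.
\<close>

lemma insert_into_dipath:
  assumes p: "dipath R s p t" "set p \<subseteq> W" and v: "v \<notin> set p"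
    and adj: "\<And>u. u \<in> set p \<Longrightarrow> R u v \<or> R v u" and s: "\<not> R v s"
    and onward: "connects R (W - {s}) v t"
  shows "\<exists>p'. dipath R s p' t \<and> insert v (set p) \<subseteq> set p' \<and> set p' \<subseteq> W"
proof (cases "\<exists>p1 a b p2. p = p1 @ a # b # p2 \<and> R a v \<and> R v b")
  case True
  then obtain p1 a b p2 where ab: "p = p1 @ a # b # p2" "R a v" "R v b" by blast
  have "dipath R s (p1 @ a # [v] @ b # p2) t"
    by (rule dipath_detour) (use p(1) ab v dipath_single in auto)
  moreover have "v \<in> W" using connects_ends[OF onward] by blast
  ultimately show ?thesis using p(2) ab(1) by (intro exI[of _ "p1 @ a # [v] @ b # p2"]) auto
next
  case False
  have all: "\<forall>u\<in>set l. R u v" if "p = l0 @ l" "l \<noteq> []" "R (hd l) v" for l0 l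
    using that
  proof (induction l arbitrary: l0)
    case Nil
    then show ?case by simp
  next
    case (Cons a l)
    show ?case
    proof (cases l)
      case Nil
      then show ?thesis using Cons.prems by simp
    next
      case (Cons b l')
      then have "\<not> R v b" using False Cons.prems by auto
      then have "R b v" using adj[of b] Cons Cons.prems by auto
      then show ?thesis using Cons.IH[of "l0 @ [a]"] Cons Cons.prems by simp
    qed
  qed
  have into: "R u v" if "u \<in> set p" for u
    using all[of "[]" p] that s adj[of s] p(1) dipath_ends[OF p(1)] by (auto simp: dipath_def)
  obtain q where q: "dipath R v q t" "set q \<subseteq> W - {s}" using onward by (rule connectsE)
  have "\<exists>x\<in>set q. x \<in> set p" using dipath_ends[OF p(1)] dipath_ends[OF q(1)] by blast
  then obtain q1 m q2 where m: "q = q1 @ m # q2" "m \<in> set p" "\<forall>x\<in>set q1. x \<notin> set p"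
    using split_list_first_prop[of q "\<lambda>x. x \<in> set p"] by blast
  have "v \<noteq> m" using v m(2) by blast
  then obtain w where w: "R w m" "dipath R v q1 w"
    using dipath_butlast[OF dipath_split(1)[OF q(1)[unfolded m(1)]]] by auto
  obtain l1 l2 where l: "p = l1 @ m # l2" using m(2) by (metis split_list)
  have "m \<noteq> s" using q(2) m(1) by auto
  then have "l1 \<noteq> []" using l p(1) by (auto simp: dipath_def)
  then obtain l0 a where a: "l1 = l0 @ [a]" by (metis rev_exhaust)
  have "dipath R s (l0 @ a # q1 @ m # l2) t"
    by (rule dipath_detour[OF _ w(2) _ w(1)]) (use p(1) l a into m(3) in auto)
  moreover have "v \<in> set q1" using dipath_ends[OF w(2)] by blast
  ultimately show ?thesis using p(2) l a q(2) m(1)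
    by (intro exI[of _ "l0 @ a # q1 @ m # l2"]) auto
qed

lemma insert_into_dipath_rev:
  assumes p: "dipath R s p t" "set p \<subseteq> W" and v: "v \<notin> set p"
    and adj: "\<And>u. u \<in> set p \<Longrightarrow> R u v \<or> R v u" and t: "\<not> R t v"
    and there: "connects R (W - {t}) s v"
  shows "\<exists>p'. dipath R s p' t \<and> insert v (set p) \<subseteq> set p' \<and> set p' \<subseteq> W"
proof -
  have "\<exists>p'. dipath (\<lambda>a b. R b a) t p' s \<and> insert v (set (rev p)) \<subseteq> set p' \<and> set p' \<subseteq> W"
  proof (rule insert_into_dipath)
    show "dipath (\<lambda>a b. R b a) t (rev p) s" using p(1) by (rule iffD2[OF dipath_rev])
    show "connects (\<lambda>a b. R b a) (W - {t}) v s" using there by (rule iffD2[OF connects_rev])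
  qed (use p(2) v adj t in auto)
  then obtain p' where p': "dipath (\<lambda>a b. R b a) t p' s" "insert v (set p) \<subseteq> set p'" "set p' \<subseteq> W"
    by auto
  have "dipath R s (rev p') t" using dipath_rev[of "\<lambda>a b. R b a" s p' t] p'(1) by simp
  then show ?thesis using p'(2,3) by (intro exI[of _ "rev p'"]) auto
qed

section \<open>A path through a prescribed vertex\<close>

text \<open>
  A fan from \<open>s\<close> to \<open>{w, t}\<close>, obtained as in Whitney's proof of the case of two paths of Menger's
  theorem, by moving the foot \<open>w\<close> of the first path along \<open>p\<close>. When the next vertex \<open>w\<close> lies on the
  current \<open>(s,t)\<close>-path \<open>Q\<close>, an \<open>(s,t)\<close>-path \<open>r\<close> avoiding \<open>w\<close> is followed from its last vertex \<open>m\<close> on the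
  other path \<open>P\<close> or on the part \<open>Q1\<close> of \<open>Q\<close> before \<open>w\<close>; that one of the two which does not contain \<open>m\<close> is
  led to \<open>w\<close>.
\<close>

lemma fan:
  assumes "dipath R s p w" "s \<noteq> w" "t \<notin> set p"
    and "\<And>v. v \<in> set p \<Longrightarrow> v \<noteq> s \<Longrightarrow> connects R (W - {v}) s t"
    and "set p \<subseteq> W"
  shows "\<exists>p1 p2. dipath R s p1 w \<and> dipath R s p2 t \<and> set p1 \<inter> set p2 = {s}
    \<and> set p1 \<subseteq> W \<and> set p2 \<subseteq> W"
  using assms
proof (induction p arbitrary: w rule: rev_induct)
  case Nil
  then show ?case by (simp add: dipath_def)
next
  case (snoc a p0)
  from dipath_butlast[OF snoc.prems(1,2)] obtain w' q
    where q0: "p0 @ [a] = q @ [w]" "R w' w" "dipath R s q w'" "w \<notin> set q" by blast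
  then have q: "a = w" "dipath R s p0 w'" "w \<notin> set p0" by auto
  obtain r where r: "dipath R s r t" "set r \<subseteq> W - {w}"
    using connectsE[OF snoc.prems(4)[of w]] snoc.prems(2) q(1) by auto
  have sW: "s \<in> W" "w \<in> W" using snoc.prems(5) dipath_ends[OF q(2)] q(1) by auto
  show ?case
  proof (cases "w' = s")
    case True
    have "dipath R s [s, w] w"
      using dipath_Cons[of R s w "[w]" w] q0(2) snoc.prems(2) True by (simp add: dipath_single)
    moreover have "set [s, w] \<inter> set r = {s}" "set [s, w] \<subseteq> W" "set r \<subseteq> W"
      using r sW dipath_ends[OF r(1)] by auto
    ultimately show ?thesis using r(1) by blast
  next
    case False
    then obtain P Q where PQ: "dipath R s P w'" "dipath R s Q t" "set P \<inter> set Q = {s}"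
        "set P \<subseteq> W" "set Q \<subseteq> W"
      using snoc.IH[OF q(2)] snoc.prems(3-5) by auto
    show ?thesis
    proof (cases "w \<in> set Q")
      case False
      have "connects R (set P \<union> {w}) s w"
        by (rule connects_trans[OF connectsI[OF PQ(1)] connects_arc[of R, OF q0(2)]])
          (use dipath_ends[OF PQ(1)] in auto)
      then obtain P' where P': "dipath R s P' w" "set P' \<subseteq> set P \<union> {w}" by (rule connectsE)
      moreover have "set P' \<inter> set Q = {s}"
        using P' PQ(3) False dipath_ends[OF P'(1)] dipath_ends[OF PQ(2)] by auto
      moreover have "set P' \<subseteq> W" using P'(2) PQ(4) sW(2) by blast
      ultimately show ?thesis using PQ(2,5) by blast
    next
      case True
      then obtain Q1 Q2 where Q: "Q = Q1 @ w # Q2" by (metis split_list)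
      have Q1: "dipath R s (Q1 @ [w]) w" by (rule dipath_split(1)[OF PQ(2)[unfolded Q]])
      have sQ1: "s \<in> set Q1"
        using dipath_ends[OF Q1] snoc.prems(2) by auto
      have wP: "w \<notin> set P" using PQ(3) True snoc.prems(2) by auto
      have "\<exists>m\<in>set r. m \<in> set P \<union> set Q1" using dipath_ends[OF r(1)] sQ1 by blast
      then obtain r1 m r2 where m: "r = r1 @ m # r2" "m \<in> set P \<union> set Q1"
          "\<forall>x\<in>set r2. x \<notin> set P \<union> set Q1"
        using split_list_last_prop[of r "\<lambda>x. x \<in> set P \<union> set Q1"] by blast
      have r2: "dipath R m (m # r2) t" by (rule dipath_split(2)[OF r(1)[unfolded m(1)]])
      have wr: "w \<notin> set r" using r(2) by blast
      have dQ: "distinct Q" using PQ(2) by (simp add: dipath_def)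
      show ?thesis
      proof (cases "m \<in> set P")
        case True
        then obtain u1 u2 where u: "P = u1 @ m # u2" by (metis split_list)
        have d: "dipath R s (u1 @ m # r2) t"
          by (rule dipath_join[OF dipath_split(1)[OF PQ(1)[unfolded u]] r2]) (use u m(3) in auto)
        have "set (Q1 @ [w]) \<inter> set (u1 @ m # r2) = {s}"
          using dipath_ends[OF d] sQ1 wP wr m u PQ(3) Q by auto
        moreover have "set (Q1 @ [w]) \<subseteq> W" "set (u1 @ m # r2) \<subseteq> W"
          using PQ(4,5) u Q m(1) r(2) by auto
        ultimately show ?thesis using Q1 d by blast
      next
        case False
        then have "m \<in> set Q1" using m(2) by blast
        then obtain u1 u2 where u: "Q1 = u1 @ m # u2" by (metis split_list)
        have d: "dipath R s (u1 @ m # r2) t"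
        proof (rule dipath_join[OF _ r2])
          show "dipath R s (u1 @ [m]) m"
            using dipath_split(1)[of R s u1 m "u2 @ w # Q2"] PQ(2) Q u by simp
        qed (use u m(3) in auto)
        have e: "dipath R s (P @ [w]) w" using dipath_snoc[OF PQ(1) q0(2) wP] .
        have "set (P @ [w]) \<inter> set (u1 @ m # r2) = {s}"
          using dipath_ends[OF d] dipath_ends[OF PQ(1)] wP wr m u PQ(3) Q dQ by auto
        moreover have "set (P @ [w]) \<subseteq> W" "set (u1 @ m # r2) \<subseteq> W"
          using PQ(4,5) u Q m(1) r(2) sW by auto
        ultimately show ?thesis using e d by blast
      qed
    qed
  qed
qed

text \<open>
  Suppose that there is no such path. The set \<open>F\<close> of common out-neighbours of \<open>s\<close> and in-neighbours of
  \<open>z\<close> is not empty: in a fan from \<open>s\<close> to \<open>{z, t}\<close> the vertex \<open>g\<close> after \<open>s\<close> on the \<open>(s,t)\<close>-path cannot satisfy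
  \<open>z \<rightarrow> g\<close>, hence \<open>g \<rightarrow> z\<close>. Every \<open>f \<in> F\<close> lies on all \<open>(z,t)\<close>-paths that avoid \<open>s\<close>, because \<open>s \<rightarrow> f \<rightarrow> z\<close> could be
  put before a path missing \<open>f\<close>. On one such path \<open>Q\<close> let \<open>f\<close> be the last vertex of \<open>F\<close>, and let \<open>g\<close> be the
  first vertex after \<open>s\<close> on an \<open>(s,t)\<close>-path \<open>M\<close> avoiding \<open>f\<close>. Either \<open>z \<rightarrow> g\<close>, or \<open>g \<in> F\<close> comes before \<open>f\<close> on
  \<open>Q\<close>; in both cases \<open>z\<close> reaches \<open>g\<close>, and along \<open>M\<close> also \<open>t\<close>, while avoiding \<open>s\<close> and \<open>f\<close>.
\<close>

lemma dipath_through: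
  assumes st: "s \<noteq> t" "z \<noteq> s" "z \<noteq> t" "\<not> R s t"
    and adj: "\<And>g. R s g \<Longrightarrow> g \<in> W - {s, z} \<Longrightarrow> R g z \<or> R z g"
    and to_z: "connects R (W - {t}) s z"
    and avoid: "\<And>w. w \<in> W - {s, t} \<Longrightarrow> connects R (W - {w}) s t"
    and from_z: "connects R (W - {s}) z t"
  shows "\<exists>p. dipath R s p t \<and> set p \<subseteq> W \<and> z \<in> set p"
proof (rule ccontr)
  assume N: "\<not> ?thesis"
  have sW: "s \<in> W" "z \<in> W" "t \<in> W" using connects_ends[OF to_z] connects_ends[OF from_z] by auto
  obtain Q where Q: "dipath R z Q t" "set Q \<subseteq> W - {s}" using from_z by (rule connectsE)
  have sz: "\<not> R s z"
  proof
    assume "R s z"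
    then have "dipath R s (s # Q) t" using dipath_Cons Q by fast
    moreover have "set (s # Q) \<subseteq> W" "z \<in> set (s # Q)" using Q sW dipath_ends[OF Q(1)] by auto
    ultimately show False using N by blast
  qed
  define F where "F = {f \<in> W - {s, t, z}. R s f \<and> R f z}"
  have F_sep: "\<not> connects R (W - {s, f}) z t" if "f \<in> F" for f
  proof
    assume "connects R (W - {s, f}) z t"
    then obtain q where q: "dipath R z q t" "set q \<subseteq> W - {s, f}" by (rule connectsE)
    have "dipath R f (f # q) t" using dipath_Cons q that unfolding F_def by fast
    then have "dipath R s (s # f # q) t"
      using dipath_Cons[of R s f "f # q" t] q that unfolding F_def by auto
    moreover have "set (s # f # q) \<subseteq> W" using q sW that unfolding F_def by auto
    moreover have "z \<in> set (s # f # q)" using dipath_ends[OF q(1)] by auto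
    ultimately show False using N by blast
  qed
  have first: "g \<in> F" if g: "R s g" "dipath R g q t" "set q \<subseteq> W - {s, z}"
      and no: "\<not> R z g" for g q
  proof -
    have "g \<in> W - {s, z}" using g dipath_ends[OF g(2)] by blast
    moreover have "g \<noteq> t" using g(1) st(4) by blast
    ultimately show ?thesis using adj g(1) no unfolding F_def by blast
  qed
  have "F \<noteq> {}"
  proof -
    obtain p where p: "dipath R s p z" "set p \<subseteq> W - {t}" using to_z by (rule connectsE)
    have "\<exists>p1 p2. dipath R s p1 z \<and> dipath R s p2 t \<and> set p1 \<inter> set p2 = {s}
        \<and> set p1 \<subseteq> W \<and> set p2 \<subseteq> W"
      by (rule fan[OF p(1)]) (use p st avoid in auto)
    then obtain p1 p2 where p12: "dipath R s p1 z" "dipath R s p2 t" "set p1 \<inter> set p2 = {s}"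
        "set p1 \<subseteq> W" "set p2 \<subseteq> W" by blast
    obtain g q where q: "p2 = s # q" "R s g" "dipath R g q t" "s \<notin> set q"
      using dipath_tl[OF p12(2) st(1)] by metis
    have zq: "z \<notin> set q" using p12(3) q dipath_ends[OF p12(1)] st by auto
    have "\<not> R z g"
    proof
      assume "R z g"
      then have "dipath R s (p1 @ q) t"
        by (rule dipath_append[OF p12(1) _ q(3)]) (use p12(3) q in auto)
      moreover have "set (p1 @ q) \<subseteq> W" "z \<in> set (p1 @ q)"
        using p12 q dipath_ends[OF p12(1)] by auto
      ultimately show False using N by blast
    qed
    then show ?thesis using first[OF q(2,3)] q p12(5) zq by auto
  qed
  have F_on: "f \<in> set Q" if "f \<in> F" for f
    using F_sep[OF that] Q by (auto intro: connectsI)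
  obtain f Q1 Q2 where f: "Q = Q1 @ f # Q2" "f \<in> F" "\<forall>x\<in>set Q2. x \<notin> F"
    using split_list_last_prop[of Q "\<lambda>x. x \<in> F"] F_on \<open>F \<noteq> {}\<close> by blast
  have fW: "f \<in> W - {s, t, z}" using f(2) by (simp add: F_def)
  then have "connects R (W - {f}) s t" using avoid by blast
  then obtain M where M: "dipath R s M t" "set M \<subseteq> W - {f}" by (rule connectsE)
  have zM: "z \<notin> set M" using N M by blast
  obtain g m where m: "M = s # m" "R s g" "dipath R g m t" "s \<notin> set m"
    using dipath_tl[OF M(1) st(1)] by metis
  have mt: "connects R (W - {s, f}) g t"
    by (rule connectsI[OF m(3)]) (use M(2) m in auto)
  have "connects R (W - {s, f}) z g"
  proof (cases "R z g")
    case True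
    then show ?thesis
      by (rule connects_arc) (use fW sW st connects_ends[OF mt] in auto)
  next
    case False
    then have "g \<in> F" using first[OF m(2,3)] M m zM by auto
    moreover have "g \<noteq> f" using connects_ends[OF mt] by blast
    ultimately have "g \<in> set Q1" using F_on f by auto
    then obtain u1 u2 where u: "Q1 = u1 @ g # u2" by (metis split_list)
    have "dipath R z (u1 @ [g]) g" using dipath_split(1)[of R z u1 g] Q(1) f(1) u by simp
    then show ?thesis
      by (rule connectsI) (use Q f(1) u in \<open>auto simp: dipath_def\<close>)
  qed
  then show False using F_sep[OF f(2)] connects_trans mt by metis
qed

section \<open>Source components\<close>

text \<open>
  Strong components without entering arcs. With all arcs reversed, these are the strong components
  without leaving arcs.
\<close>

definition source_comp :: "('a \<Rightarrow> 'a \<Rightarrow> bool) \<Rightarrow> 'a set \<Rightarrow> 'a set \<Rightarrow> bool" where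
  "source_comp R H A \<longleftrightarrow> A \<noteq> {} \<and> A \<subseteq> H \<and> (\<forall>u\<in>H. \<forall>v\<in>A. R u v \<longrightarrow> u \<in> A)
    \<and> (\<forall>u\<in>A. \<forall>v\<in>A. connects R A u v)"

text \<open>
  The set of vertices from which a given vertex can be reached is such a component as soon as it is
  smallest possible, for then all of its members have the same set.
\<close>

lemma source_comp_exists:
  assumes "finite H" "H \<noteq> {}"
  shows "\<exists>A. source_comp R H A"
proof -
  define anc where "anc v = {u \<in> H. connects R H u v}" for v
  obtain h where "h \<in> H" using assms(2) by blast
  then obtain a where a: "a \<in> H" "\<And>v. v \<in> H \<Longrightarrow> card (anc a) \<le> card (anc v)"
    using ex_has_least_nat[of "\<lambda>v. v \<in> H" h "\<lambda>v. card (anc v)"] by blast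
  have same: "anc v = anc a" if "v \<in> anc a" for v
  proof (rule card_seteq)
    show "finite (anc a)" using assms(1) by (simp add: anc_def)
    show "anc v \<subseteq> anc a" using that connects_trans unfolding anc_def by fast
    show "card (anc a) \<le> card (anc v)" using a(2) that by (simp add: anc_def)
  qed
  have "connects R (anc a) u v" if "u \<in> anc a" "v \<in> anc a" for u v
  proof -
    have "u \<in> anc v" using same[OF that(2)] that(1) by blast
    then obtain p where p: "dipath R u p v" "set p \<subseteq> H"
      unfolding anc_def connects_def by blast
    have "m \<in> anc v" if m: "m \<in> set p" for m
    proof -
      obtain p1 p2 where "p = p1 @ m # p2" using m by (metis split_list)
      then have "dipath R m (m # p2) v" "set (m # p2) \<subseteq> H" using dipath_split(2) p by auto
      then show ?thesis using m p(2) unfolding anc_def connects_def by blast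
    qed
    then show ?thesis using same[OF that(2)] p(1) by (auto intro: connectsI)
  qed
  moreover have "a \<in> anc a" using a(1) connects_refl by (simp add: anc_def)
  moreover have "u \<in> anc a" if "u \<in> H" "v \<in> anc a" "R u v" for u v
    using that connects_step[of R u v H a] by (simp add: anc_def)
  ultimately have "source_comp R H (anc a)"
    unfolding source_comp_def anc_def by blast
  then show ?thesis ..
qed

lemma saturate_dipath:
  assumes "finite W" "dipath R s p0 t" "set p0 \<subseteq> W"
    and step: "\<And>p k. dipath R s p t \<Longrightarrow> set p \<subseteq> W \<Longrightarrow> set p0 \<subseteq> set p \<Longrightarrow> k \<in> K - c ` set p \<Longrightarrow>
      \<exists>h. c h = k \<and> (\<exists>p'. dipath R s p' t \<and> insert h (set p) \<subseteq> set p' \<and> set p' \<subseteq> W)"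
  shows "\<exists>p. dipath R s p t \<and> set p \<subseteq> W \<and> set p0 \<subseteq> set p \<and> K \<subseteq> c ` set p"
proof -
  define P where "P p \<longleftrightarrow> dipath R s p t \<and> set p \<subseteq> W \<and> set p0 \<subseteq> set p" for p
  have "P p0" using assms by (simp add: P_def)
  moreover have "\<forall>p. P p \<longrightarrow> card (set p) < Suc (card W)"
    using card_mono[OF assms(1)] unfolding P_def by (simp add: less_Suc_eq_le)
  ultimately obtain p where p: "P p" "\<And>p'. P p' \<Longrightarrow> card (set p') \<le> card (set p)"
    using ex_has_greatest_nat[of P p0 "\<lambda>p. card (set p)"] by blast
  have "K \<subseteq> c ` set p"
  proof
    fix k assume "k \<in> K"
    show "k \<in> c ` set p"
    proof (rule ccontr)
      assume k: "k \<notin> c ` set p"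
      then obtain h p' where h: "c h = k" "dipath R s p' t" "insert h (set p) \<subseteq> set p'" "set p' \<subseteq> W"
        using step[of p k] p(1) \<open>k \<in> K\<close> unfolding P_def by blast
      then have "set p \<subset> set p'" using k by blast
      then have "card (set p) < card (set p')" by (simp add: psubset_card_mono)
      moreover have "P p'" using h p(1) unfolding P_def by blast
      ultimately show False using p(2) by fastforce
    qed
  qed
  then show ?thesis using p(1) unfolding P_def by blast
qed

section \<open>Semicomplete multipartite digraphs with a vertex triple whose deletion is not strong\<close>

text \<open>
  The digraph is reduced to its vertices, its adjacency relation and a colouring by its classes.
  This form is invariant under reversing all arcs and exchanging \<open>x\<close> with \<open>y\<close> (lemma \<open>dual\<close>). The set
  \<open>H\<close> is a parameter so that it is literally the same set after this exchange.
\<close>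

locale nonstrong_deletion =
  fixes V :: "'a set" and E :: "'a \<Rightarrow> 'a \<Rightarrow> bool" and col :: "'a \<Rightarrow> 'c" and x y z :: 'a
    and H :: "'a set"
  assumes finV: "finite V"
    and H_eq: "H = V - {x, y, z}"
    and adj: "u \<in> V \<Longrightarrow> v \<in> V \<Longrightarrow> E u v \<or> E v u \<longleftrightarrow> col u \<noteq> col v"
    and xyz: "x \<in> V" "y \<in> V" "z \<in> V" "x \<noteq> y" "x \<noteq> z" "y \<noteq> z"
    and no_2cycle_x: "E x v \<Longrightarrow> \<not> E v x"
    and no_2cycle_y: "E y v \<Longrightarrow> \<not> E v y"
    and strong_x: "u \<in> V - {x, w} \<Longrightarrow> v \<in> V - {x, w} \<Longrightarrow> connects E (V - {x, w}) u v"
    and strong_y: "u \<in> V - {y, w} \<Longrightarrow> v \<in> V - {y, w} \<Longrightarrow> connects E (V - {y, w}) u v"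
    and not_strong: "\<exists>u\<in>H. \<exists>v\<in>H. \<not> connects E H u v"
    and colours: "\<exists>h\<in>H. col h \<notin> {k1, k2, k3}"
begin

lemma H_sub: "H \<subseteq> V" and xyz_notin: "x \<notin> H" "y \<notin> H" "z \<notin> H"
  unfolding H_eq by auto

lemma arc_colours: "E u v \<Longrightarrow> u \<in> H \<Longrightarrow> v \<in> H \<Longrightarrow> col u \<noteq> col v"
  using adj[of u v] H_sub by blast

lemma dual: "nonstrong_deletion V (\<lambda>u v. E v u) col y x z H"
proof
  show "H = V - {y, x, z}" using H_eq by blast
  show "(E v u \<or> E u v) = (col u \<noteq> col v)" if "u \<in> V" "v \<in> V" for u v
    using adj that by blast
  show "connects (\<lambda>u v. E v u) (V - {y, w}) u v" if "u \<in> V - {y, w}" "v \<in> V - {y, w}" for u v w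
    by (rule iffD2[OF connects_rev strong_y[OF that(2,1)]])
  show "connects (\<lambda>u v. E v u) (V - {x, w}) u v" if "u \<in> V - {x, w}" "v \<in> V - {x, w}" for u v w
    by (rule iffD2[OF connects_rev strong_x[OF that(2,1)]])
  show "\<exists>u\<in>H. \<exists>v\<in>H. \<not> connects (\<lambda>u v. E v u) H u v"
    using not_strong connects_rev[of E H] by metis
qed (use finV xyz no_2cycle_x no_2cycle_y colours in auto)

text \<open>
  An arc into \<open>A'\<close> exists in \<open>D - {y, w}\<close>. If every arc from the rest of \<open>A\<close> into \<open>A'\<close> comes from \<open>w\<close>,
  it can only start in \<open>x\<close> or \<open>z\<close>.
\<close>

lemma entered:
  assumes "source_comp E H A" "A' \<subseteq> A" "A' \<noteq> {}" "w \<notin> A'"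
    and "\<And>u v. u \<in> A - A' \<Longrightarrow> v \<in> A' \<Longrightarrow> E u v \<Longrightarrow> u = w"
  shows "\<exists>v\<in>A'. w \<noteq> x \<and> E x v \<or> w \<noteq> z \<and> E z v"
proof -
  have sub: "A' \<subseteq> H" using assms(1,2) unfolding source_comp_def by blast
  obtain v where v: "v \<in> A'" using assms(3) by blast
  define r where "r = (if w = x then z else x)"
  have "r \<in> V - {y, w}" "r \<notin> A'" using xyz sub xyz_notin unfolding r_def by auto
  moreover have "v \<in> V - {y, w}" using v sub H_sub xyz_notin assms(4) by blast
  ultimately obtain u' v' where uv: "E u' v'" "u' \<in> (V - {y, w}) - A'" "v' \<in> (V - {y, w}) \<inter> A'"
    using connects_enters[OF strong_y _ v] by metis
  have "u' \<notin> H"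
  proof
    assume "u' \<in> H"
    then have "u' \<in> A" using assms(1,2) uv unfolding source_comp_def by blast
    then show False using assms(5) uv by blast
  qed
  then have "u' = x \<or> u' = z" using uv(2) H_eq by blast
  then show ?thesis using uv by blast
qed

lemma entered_from:
  assumes "source_comp E H A"
  shows "\<exists>v\<in>A. E x v" "\<exists>v\<in>A. E z v" "\<exists>v\<in>A. E y v"
proof -
  have A: "A \<noteq> {}" "A \<subseteq> H" "\<And>u v. u \<in> H \<Longrightarrow> v \<in> A \<Longrightarrow> E u v \<Longrightarrow> u \<in> A"
    using assms unfolding source_comp_def by blast+
  show "\<exists>v\<in>A. E x v" using entered[OF assms, of A z] A xyz_notin by auto
  show "\<exists>v\<in>A. E z v" using entered[OF assms, of A x] A xyz_notin by auto
  obtain v where v: "v \<in> A" using A(1) by blast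
  then have "v \<in> V - {x, z}" using A(2) H_eq by blast
  moreover have "y \<in> V - {x, z}" "y \<notin> A" using xyz A(2) xyz_notin by auto
  ultimately obtain u' v' where "E u' v'" "u' \<in> (V - {x, z}) - A" "v' \<in> (V - {x, z}) \<inter> A"
    using connects_enters[OF strong_x _ v] by metis
  then show "\<exists>v\<in>A. E y v" using A(3) H_eq by blast
qed

text \<open>
  Only vertices of \<open>H\<close> are ever inserted into paths, so every missing colour has to occur there.
\<close>

lemma missing_in_H:
  assumes "k \<in> col ` V" "k \<notin> col ` P" "x \<in> P" "y \<in> P" "z \<in> P \<or> (\<exists>u\<in>V - {z}. col u = col z)"
  shows "\<exists>h\<in>H. col h = k"
proof -
  obtain v where v: "v \<in> V" "col v = k" using assms(1) by blast
  show ?thesis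
  proof (cases "v = z")
    case False
    then show ?thesis using v assms(2-4) H_eq by blast
  next
    case True
    then obtain u where "u \<in> V - {z}" "col u = k" using assms(2,5) v by blast
    then show ?thesis using assms(2-4) H_eq by blast
  qed
qed

text \<open>
  Since \<open>y\<close> sends an arc to \<open>a\<close> and lies on no 2-cycle, the arc from \<open>a\<close> to \<open>y\<close> that \<open>dipath_through\<close>
  forbids is absent. A vertex \<open>h\<close> of \<open>H\<close> whose colour is missing sends no arc to \<open>a\<close>, and
  it reaches \<open>y\<close> in \<open>D - {x, a}\<close>, so it can be inserted.
\<close>

lemma spanning_from_singleton_source:
  assumes a: "source_comp E H {a}"
  shows "\<exists>p. dipath E x p y \<and> col ` V \<subseteq> col ` set p"
proof -
  have arcs: "E x a" "E y a" using entered_from[OF a] by auto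
  have aH: "a \<in> H" and closed: "\<And>u. u \<in> H \<Longrightarrow> E u a \<Longrightarrow> u = a"
    using a unfolding source_comp_def by auto
  have nay: "\<not> E a y" using arcs no_2cycle_y by blast
  have aV: "a \<in> V - {x, y, z}" using aH H_eq by blast
  have W: "V - {x} - {w} = V - {x, w}" for w by auto
  have "\<exists>p. dipath E a p y \<and> set p \<subseteq> V - {x} \<and> (z \<in> set p \<or> (\<exists>u\<in>V - {z}. col u = col z))"
  proof (cases "\<exists>u\<in>V - {z}. col u = col z")
    case True
    have "connects E (V - {x, x}) a y" by (rule strong_x) (use aV xyz in auto)
    then show ?thesis using True unfolding connects_def by auto
  next
    case False
    have "\<exists>p. dipath E a p y \<and> set p \<subseteq> V - {x} \<and> z \<in> set p"
    proof (rule dipath_through)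
      show "\<not> E a y" by (fact nay)
      show "E g z \<or> E z g" if "E a g" "g \<in> V - {x} - {a, z}" for g
        using that False adj[of g z] xyz by blast
      show "connects E (V - {x} - {y}) a z" unfolding W
        by (rule strong_x) (use aV xyz in auto)
      show "connects E (V - {x} - {a}) z y" unfolding W
        by (rule strong_x) (use aV xyz in auto)
      show "connects E (V - {x} - {w}) a y" if "w \<in> V - {x} - {a, y}" for w unfolding W
        by (rule strong_x) (use that aV xyz in auto)
    qed (use aV xyz in auto)
    then show ?thesis by blast
  qed
  then obtain p0 where p0: "dipath E a p0 y" "set p0 \<subseteq> V - {x}"
    "z \<in> set p0 \<or> (\<exists>u\<in>V - {z}. col u = col z)" by blast
  have "\<exists>p. dipath E a p y \<and> set p \<subseteq> V - {x} \<and> set p0 \<subseteq> set p \<and> col ` V - {col x} \<subseteq> col ` set p"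
  proof (rule saturate_dipath[OF _ p0(1,2)])
    show "finite (V - {x})" using finV by simp
  next
    fix p k
    assume p: "dipath E a p y" "set p \<subseteq> V - {x}" "set p0 \<subseteq> set p"
      and k: "k \<in> col ` V - {col x} - col ` set p"
    have ends: "a \<in> set p" "y \<in> set p" using dipath_ends[OF p(1)] by auto
    obtain h where h: "h \<in> H" "col h = k"
      using missing_in_H[of k "insert x (set p)"] k ends p(3) p0(3) by auto
    have new: "h \<notin> set p" using h(2) k by (metis DiffD2 imageI)
    have "\<exists>p'. dipath E a p' y \<and> insert h (set p) \<subseteq> set p' \<and> set p' \<subseteq> V - {x}"
    proof (rule insert_into_dipath[OF p(1,2) new])
      show "E u h \<or> E h u" if "u \<in> set p" for u
      proof -
        have "col u \<noteq> col h" using that h(2) k by (metis DiffD2 imageI)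
        then show ?thesis using adj[of u h] that p(2) h(1) H_sub by blast
      qed
      show "\<not> E h a" using closed h new ends by blast
      show "connects E (V - {x} - {a}) h y" unfolding W
        by (rule strong_x) (use h new ends aV xyz xyz_notin H_sub in auto)
    qed
    then show "\<exists>h. col h = k \<and> (\<exists>p'. dipath E a p' y \<and> insert h (set p) \<subseteq> set p' \<and> set p' \<subseteq> V - {x})"
      using h(2) by blast
  qed
  then obtain p where p: "dipath E a p y" "set p \<subseteq> V - {x}" "col ` V - {col x} \<subseteq> col ` set p"
    by blast
  have "dipath E x (x # p) y" by (rule dipath_Cons[of E, OF arcs(1) p(1)]) (use p(2) in blast)
  moreover have "col ` V \<subseteq> col ` set (x # p)" using p(3) by auto
  ultimately show ?thesis by blast
qed

end

section \<open>Nontrivial source and sink components\<close>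

locale nontrivial_ends = nonstrong_deletion +
  fixes A B :: "'a set"
  assumes source: "source_comp E H A" and sink: "source_comp (\<lambda>u v. E v u) H B"
    and A_nontrivial: "A \<noteq> {a}" and B_nontrivial: "B \<noteq> {b}"
begin

lemma dual_ends: "nontrivial_ends V (\<lambda>u v. E v u) col y x z H B A"
proof -
  interpret d: nonstrong_deletion V "\<lambda>u v. E v u" col y x z H by (rule dual)
  show ?thesis
    by unfold_locales (use source sink A_nontrivial B_nontrivial in auto)
qed

lemma A_sub: "A \<subseteq> H" and A_back: "u \<in> H \<Longrightarrow> v \<in> A \<Longrightarrow> E u v \<Longrightarrow> u \<in> A"
  and A_strong: "u \<in> A \<Longrightarrow> v \<in> A \<Longrightarrow> connects E A u v"
  using source unfolding source_comp_def by blast+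

lemma B_sub: "B \<subseteq> H" and B_forward: "u \<in> B \<Longrightarrow> v \<in> H \<Longrightarrow> E u v \<Longrightarrow> v \<in> B"
  and B_strong: "u \<in> B \<Longrightarrow> v \<in> B \<Longrightarrow> connects E B u v"
  using sink connects_rev[of E B] unfolding source_comp_def by blast+

lemma A_other: "\<exists>u\<in>A. u \<noteq> v"
  using source A_nontrivial[of v] unfolding source_comp_def by auto

text \<open>
  Arcs join different colours, and a strong component with two vertices contains an arc.
\<close>

lemma A_two_colours: "\<exists>u\<in>A. col u \<noteq> k"
proof (rule ccontr)
  assume mono: "\<not> ?thesis"
  obtain v u where uv: "v \<in> A" "u \<in> A" "u \<noteq> v" using A_other by blast
  have "u \<notin> {v}" "v \<in> {v}" using uv by auto
  then obtain u' v' where "E u' v'" "u' \<in> A" "v' \<in> A"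
    using connects_enters[OF A_strong[OF uv(2,1)], of "{v}"] by blast
  moreover have "col u' = col v'" using mono calculation by auto
  ultimately show False using adj[of u' v'] A_sub H_sub by auto
qed

text \<open>
  If the components met, they would coincide. Then no arc would join \<open>A\<close> to the rest of \<open>H\<close>, so all
  vertices of \<open>A\<close> would share the colour of any vertex of \<open>H\<close> outside.
\<close>

lemma A_B_disjoint: "A \<inter> B = {}"
proof (rule ccontr)
  assume "\<not> ?thesis"
  then obtain u where u: "u \<in> A" "u \<in> B" by blast
  have "b \<in> A" if bB: "b \<in> B" for b
  proof (rule ccontr)
    assume b: "b \<notin> A"
    obtain u' v' where "E u' v'" "u' \<in> B - A" "v' \<in> B \<inter> A"
      using connects_enters[OF B_strong[OF bB u(2)] b u(1)] by blast
    then show False using A_back B_sub by blast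
  qed
  moreover have "v \<in> B" if vA: "v \<in> A" for v
  proof (rule ccontr)
    assume v: "v \<notin> B"
    obtain u' v' where "E u' v'" "u' \<in> A - - B" "v' \<in> A \<inter> - B"
      using connects_enters[OF A_strong[OF u(1) vA], of "- B"] u(2) v by blast
    then show False using B_forward A_sub by blast
  qed
  ultimately have AB: "A = B" by blast
  have "A \<noteq> H"
    using not_strong A_strong by blast
  then obtain h where h: "h \<in> H" "h \<notin> A" using A_sub by blast
  obtain a where a: "a \<in> A" "col a \<noteq> col h" using A_two_colours by blast
  have "a \<in> V" "h \<in> V" using a(1) h(1) A_sub H_sub by auto
  then have "E a h \<or> E h a" using adj a(2) by simp
  then show False using A_back[OF h(1) a(1)] B_forward[OF _ h(1), of a] AB h(2) a(1) by blast
qed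

lemma A_dominates:
  assumes "u \<in> A" "v \<in> H - A" "col u \<noteq> col v"
  shows "E u v"
proof -
  have "u \<in> V" "v \<in> V" using assms A_sub H_sub by auto
  then have "E u v \<or> E v u" using adj assms(3) by simp
  then show ?thesis using A_back[of v u] assms by blast
qed

end

context nontrivial_ends
begin

interpretation dual: nontrivial_ends V "\<lambda>u v. E v u" col y x z H B A by (rule dual_ends)

lemmas B_two_colours = dual.A_two_colours
lemmas dominates_B = dual.A_dominates

text \<open>
  One of the two components does not contain \<open>w\<close>. If this is \<open>A\<close>, move inside \<open>A\<close> to a vertex whose
  colour differs from that of \<open>b\<close>; such a vertex has an arc to \<open>b\<close>.
\<close>

lemma connects_A_B:
  assumes "a \<in> A" "b \<in> B" "w \<noteq> a" "w \<noteq> b"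
  shows "connects E (H - {w}) a b"
proof (cases "w \<in> A")
  case False
  obtain a' where a': "a' \<in> A" "col a' \<noteq> col b" using A_two_colours by blast
  have "connects E (H - {w}) a a'"
    by (rule connects_subset[OF A_strong]) (use assms a' False A_sub in auto)
  moreover have "connects E (H - {w}) a' b"
    by (rule connects_arc[of E, OF A_dominates])
      (use assms a' False A_sub B_sub A_B_disjoint in auto)
  ultimately show ?thesis by (rule connects_trans)
next
  case True
  then have w: "w \<notin> B" using A_B_disjoint by blast
  obtain b' where b': "b' \<in> B" "col a \<noteq> col b'" using B_two_colours by metis
  have "connects E (H - {w}) b' b"
    by (rule connects_subset[OF B_strong]) (use assms b' w B_sub in auto)
  moreover have "connects E (H - {w}) a b'"
    by (rule connects_arc[of E, OF A_dominates])
      (use assms b' w A_sub B_sub A_B_disjoint in auto)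
  ultimately show ?thesis using connects_trans by metis
qed

text \<open>
  A vertex \<open>h\<close> of \<open>H\<close> whose colour is missing is inserted from the start \<open>a\<close> if it is outside \<open>A\<close>: it
  sends no arc to \<open>a\<close>, and it reaches \<open>b\<close> within \<open>B\<close> or by an arc. A vertex of \<open>A\<close> is inserted from the
  end \<open>b\<close>, from which it receives no arc, and is reached from \<open>a\<close> within \<open>A\<close>.
\<close>

lemma spanning_from_end_path:
  assumes ab: "a \<in> A" "b \<in> B" "E x a" "E b y"
    and p0: "dipath E a p0 b" "set p0 \<subseteq> V - {x, y}"
    and z: "z \<in> set p0 \<or> (\<exists>u\<in>V - {z}. col u = col z)"
  shows "\<exists>p. dipath E x p y \<and> col ` V \<subseteq> col ` set p"
proof -
  have "\<exists>p. dipath E a p b \<and> set p \<subseteq> V - {x, y} \<and> set p0 \<subseteq> set p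
      \<and> col ` V - {col x, col y} \<subseteq> col ` set p"
  proof (rule saturate_dipath[OF _ p0(1,2)])
    show "finite (V - {x, y})" using finV by simp
  next
    fix p k
    assume p: "dipath E a p b" "set p \<subseteq> V - {x, y}" "set p0 \<subseteq> set p"
      and k: "k \<in> col ` V - {col x, col y} - col ` set p"
    have ends: "a \<in> set p" "b \<in> set p" using dipath_ends[OF p(1)] by auto
    obtain h where h: "h \<in> H" "col h = k"
      using missing_in_H[of k "set p \<union> {x, y}"] k p(3) z by auto
    have new: "h \<notin> set p" using h(2) k by (metis DiffD2 imageI)
    have adjp: "E u h \<or> E h u" if "u \<in> set p" for u
    proof -
      have "col u \<noteq> col h" using that h(2) k by (metis DiffD2 imageI)
      then show ?thesis using adj[of u h] that p(2) h(1) H_sub by blast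
    qed
    have WH: "H \<subseteq> V - {x, y}" using H_eq by blast
    have "\<exists>p'. dipath E a p' b \<and> insert h (set p) \<subseteq> set p' \<and> set p' \<subseteq> V - {x, y}"
    proof (cases "h \<in> A")
      case False
      show ?thesis
      proof (rule insert_into_dipath[OF p(1,2) new adjp])
        show "\<not> E h a" using A_back[OF h(1) ab(1)] False by blast
        have bh: "E h b \<or> h \<in> B"
          using adjp[OF ends(2)] B_forward[OF ab(2) h(1)] by blast
        show "connects E (V - {x, y} - {a}) h b"
        proof (cases "h \<in> B")
          case True
          show ?thesis
            by (rule connects_subset[OF B_strong[OF True ab(2)]])
              (use B_sub WH ab A_B_disjoint in blast)
        next
          case nB: False
          then show ?thesis using bh
            by (intro connects_arc[of E]) (use ab h new ends WH B_sub A_B_disjoint in auto)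
        qed
      qed
    next
      case True
      then have hB: "h \<notin> B" using A_B_disjoint by blast
      show ?thesis
      proof (rule insert_into_dipath_rev[OF p(1,2) new adjp])
        show "\<not> E b h" using B_forward[OF ab(2) h(1)] hB by blast
        show "connects E (V - {x, y} - {b}) a h"
          by (rule connects_subset[OF A_strong[OF ab(1) True]])
            (use A_sub WH ab A_B_disjoint in blast)
      qed
    qed
    then show "\<exists>h. col h = k \<and>
        (\<exists>p'. dipath E a p' b \<and> insert h (set p) \<subseteq> set p' \<and> set p' \<subseteq> V - {x, y})"
      using h(2) by blast
  qed
  then obtain p where p: "dipath E a p b" "set p \<subseteq> V - {x, y}"
    "col ` V - {col x, col y} \<subseteq> col ` set p"
    by blast
  have "dipath E a (p @ [y]) y" by (rule dipath_snoc[of E, OF p(1) ab(4)]) (use p(2) in blast)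
  then have "dipath E x (x # p @ [y]) y"
    by (rule dipath_Cons[of E, OF ab(3)]) (use p(2) xyz in auto)
  moreover have "col ` V \<subseteq> col ` set (x # p @ [y])" using p(3) by auto
  ultimately show ?thesis by blast
qed

section \<open>Leading a path between the end components through the third vertex\<close>

text \<open>
  Besides the first vertex \<open>s\<close> of the path to be constructed, \<open>z\<close> has another out-neighbour in \<open>A\<close>:
  if \<open>s \<in> A\<close>, then in \<open>D - {y, s}\<close> an arc from \<open>x\<close> or \<open>z\<close> enters \<open>A - {s}\<close>, and by assumption it does not come
  from \<open>x\<close>.
\<close>

lemma second_entry:
  assumes "s \<noteq> z" "s \<in> A \<Longrightarrow> (\<forall>u\<in>A. E x u \<longrightarrow> u = s)"
  shows "\<exists>u\<in>A. E z u \<and> u \<noteq> s"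
proof (cases "s \<in> A")
  case True
  have "\<exists>v\<in>A - {s}. s \<noteq> x \<and> E x v \<or> s \<noteq> z \<and> E z v"
    by (rule entered[OF source]) (use A_other[of s] in auto)
  then show ?thesis using assms(2) True by blast
next
  case False
  then show ?thesis using entered_from(2)[OF source] by blast
qed

text \<open>
  Suppose that every \<open>(a,b)\<close>-path in \<open>H - {w}\<close> is the single arc from \<open>a\<close> to \<open>b\<close>. Then \<open>B - {b}\<close> has only
  the colour of \<open>a\<close>, and \<open>a\<close> has no out-neighbours in \<open>H\<close> except \<open>w\<close> and \<open>b\<close>, where \<open>w \<in> A\<close>. A vertex \<open>s\<close> of
  \<open>H\<close> that differs in colour from \<open>a\<close>, \<open>b\<close> and \<open>w\<close> therefore lies in \<open>A\<close>. As \<open>w\<close> is the only way out of \<open>a\<close>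
  inside \<open>A\<close>, and \<open>a\<close> is the only out-neighbour of \<open>x\<close> in \<open>A\<close>, strength of \<open>D - {y, w}\<close> yields an
  out-neighbour \<open>e\<close> of \<open>z\<close> that reaches \<open>s\<close> in \<open>A - {a, w}\<close>. The
  path is \<open>a, w, b', z, e, \<dots>, s, b\<close>.
\<close>

lemma z_path_of_cut_arc:
  assumes a: "a \<in> A" "E x a" "\<And>u. u \<in> A \<Longrightarrow> E x u \<Longrightarrow> u = a"
    and b: "b \<in> B" "b' \<in> B" "b' \<noteq> b" "E b' z"
    and w: "w \<noteq> a" "w \<notin> B"
    and cut: "\<not> connects (\<lambda>u v. E u v \<and> \<not> (u = a \<and> v = b)) (H - {w}) a b"
  shows "\<exists>q. dipath E a q b \<and> set q \<subseteq> V - {x, y} \<and> z \<in> set q"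
proof -
  let ?R = "\<lambda>u v. E u v \<and> \<not> (u = a \<and> v = b)"
  have AB: "a \<notin> B" "b \<notin> A" "a \<noteq> b" using a(1) b(1) A_B_disjoint by auto
  have inH: "a \<in> H" "b \<in> H" "b' \<in> H" using a(1) b A_sub B_sub by auto
  have B_mono: "col t = col a" if t: "t \<in> B" "t \<noteq> b" for t
  proof (rule ccontr)
    assume "col t \<noteq> col a"
    then have "E a t" using A_dominates[of a t] a(1) t B_sub A_B_disjoint by auto
    then have "connects ?R (H - {w}) a t"
      using t inH w B_sub by (intro connects_arc[of ?R]) auto
    moreover have "connects ?R (H - {w}) t b"
      by (rule connects_mono[OF B_strong[OF t(1) b(1)]]) (use B_sub w AB in auto)
    ultimately show False using cut connects_trans[of ?R] by blast
  qed
  have colb: "col b \<noteq> col a"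
    using B_two_colours[of "col a"] B_mono by auto
  obtain c where c: "c \<in> B" "c \<noteq> b" "E c b"
  proof -
    have "connects E B b' b" by (rule B_strong[OF b(2,1)])
    then obtain u v where "E u v" "u \<in> B - {b}" "v \<in> B \<inter> {b}"
      using connects_enters[of E B b' b "{b}"] b(3) by blast
    then show thesis using that by blast
  qed
  have only: "n = w \<or> n = b" if n: "n \<in> H" "E a n" for n
  proof (rule ccontr)
    assume "\<not> (n = w \<or> n = b)"
    then have nw: "n \<noteq> w" "n \<noteq> b" by auto
    have "col n \<noteq> col a" using arc_colours[of a n] n inH by auto
    then have "n \<notin> B" "col n \<noteq> col c" using B_mono[of n] B_mono[OF c(1,2)] nw by auto
    then have "E n c" using dominates_B[of c n] c(1) n(1) by auto
    then have "connects ?R (H - {w}) n b"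
      using b(1) c n nw w B_sub inH AB
      by (intro connects_step[of ?R n c] connects_arc[of ?R c]) auto
    then have "connects ?R (H - {w}) a b"
      using n nw w inH by (intro connects_step[of ?R a n]) auto
    then show False using cut by blast
  qed
  obtain a' where "a' \<in> A" "a' \<noteq> a" using A_other by blast
  then obtain u v where "E u v" "u \<in> A - - {a}" "v \<in> A \<inter> - {a}"
    using connects_enters[OF A_strong[of a a'], of "- {a}"] a(1) by blast
  then have aw: "E a w" "w \<in> A" using only[of v] A_sub AB by auto
  obtain s where s: "s \<in> H" "col s \<noteq> col a" "col s \<noteq> col b" "col s \<noteq> col w"
    using colours[of "col a" "col b" "col w"] by auto
  have sA: "s \<in> A"
  proof (rule ccontr)
    assume "s \<notin> A"
    then have "E a s" using A_dominates[of a s] a(1) s by auto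
    then show False using only[of s] s by auto
  qed
  \<comment> \<open>Only \<open>w\<close> sends arcs from the rest of \<open>A\<close> to the set of vertices that reach \<open>s\<close> in \<open>A - {a, w}\<close>.\<close>
  define A' where "A' = {v \<in> A - {a, w}. connects E (A - {a, w}) v s}"
  have "\<exists>v\<in>A'. w \<noteq> x \<and> E x v \<or> w \<noteq> z \<and> E z v"
  proof (rule entered[OF source])
    have "s \<in> A'" using sA s connects_refl[of s "A - {a, w}" E] unfolding A'_def by auto
    then show "A' \<noteq> {}" by blast
  next
    fix u v assume uv: "u \<in> A - A'" "v \<in> A'" "E u v"
    have v: "v \<in> A" "v \<noteq> a" "v \<noteq> w" "connects E (A - {a, w}) v s"
      using uv(2) unfolding A'_def by auto
    have "u \<noteq> a" using only[of v] uv(3) v A_sub AB by blast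
    moreover have "u \<in> A'" if "u \<noteq> a" "u \<noteq> w"
      using that uv v connects_step[of E u v "A - {a, w}" s] unfolding A'_def by auto
    ultimately show "u = w" using uv(1) by blast
  qed (auto simp: A'_def)
  then obtain e where e: "e \<in> A'" "E z e"
    using a(3) unfolding A'_def by auto
  obtain q where q: "dipath E e q s" "set q \<subseteq> A - {a, w}"
    using e(1) unfolding A'_def by (auto elim: connectsE)
  have "w \<in> H" using aw(2) A_sub by blast
  then have "E w b'"
    using A_dominates[of w b'] aw(2) inH(3) b(2) A_B_disjoint B_mono[OF b(2,3)]
      arc_colours[of a w] aw inH A_sub by auto
  moreover have "E s b"
    using A_dominates[of s b] sA inH(2) AB s(3) by auto
  moreover have "z \<notin> A" "z \<notin> B" "z \<noteq> a" "z \<noteq> w" "z \<noteq> b" "z \<noteq> b'"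
    using xyz_notin A_sub B_sub inH aw(2) by auto
  moreover have "b' \<notin> A" "b' \<noteq> a" "b' \<noteq> w" "b \<noteq> w"
    using b A_B_disjoint a(1) w by auto
  ultimately have "dipath E a ([a, w, b', z] @ q @ [b]) b"
    using q aw(1) b e(2) AB w a(1) unfolding dipath_def
    by (auto simp: successively_append_iff successively_Cons)
  moreover have "set ([a, w, b', z] @ q @ [b]) \<subseteq> V - {x, y}"
  proof -
    have "set ([a, w, b', z] @ q @ [b]) \<subseteq> insert z H" using q(2) inH aw(2) A_sub by auto
    then show ?thesis using xyz H_eq by auto
  qed
  moreover have "z \<in> set ([a, w, b', z] @ q @ [b])" by simp
  ultimately show ?thesis by blast
qed

end

context nontrivial_ends
begin

interpretation dual: nontrivial_ends V "\<lambda>u v. E v u" col y x z H B A by (rule dual_ends)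

text \<open>
  The theorem \<open>dipath_through\<close> requires that no vertex other than the ends separates them. A vertex
  \<open>a\<close> that is the only out-neighbour of \<open>x\<close> in \<open>A\<close> would do so; in that case the path is started in \<open>a\<close>
  instead of \<open>x\<close>, and symmetrically it is ended in \<open>b\<close> instead of \<open>y\<close>. In the digraph \<open>R\<close>, paths leave \<open>x\<close>
  only into \<open>A\<close> and reach \<open>y\<close> only from \<open>B\<close>, and the arc from the start \<open>s\<close> to the end \<open>t\<close> is removed.
\<close>

lemma end_path_through_z:
  assumes alone: "\<And>u. u \<in> V \<Longrightarrow> u \<noteq> z \<Longrightarrow> col u \<noteq> col z"
  shows "\<exists>a\<in>A. \<exists>b\<in>B. \<exists>q. E x a \<and> E b y \<and> dipath E a q b \<and> set q \<subseteq> V - {x, y} \<and> z \<in> set q"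
proof (rule ccontr)
  assume none: "\<not> ?thesis"
  obtain s where s: "s = x \<and> (\<forall>w. \<exists>a\<in>A. E x a \<and> a \<noteq> w)
      \<or> s \<in> A \<and> E x s \<and> (\<forall>a\<in>A. E x a \<longrightarrow> a = s)"
  proof -
    obtain a where "a \<in> A" "E x a" using entered_from(1)[OF source] by blast
    then show thesis using that[of x] that[of a] by metis
  qed
  obtain t where t: "t = y \<and> (\<forall>w. \<exists>b\<in>B. E b y \<and> b \<noteq> w)
      \<or> t \<in> B \<and> E t y \<and> (\<forall>b\<in>B. E b y \<longrightarrow> b = t)"
  proof -
    obtain b where "b \<in> B" "E b y" using dual.entered_from(1)[OF sink] by blast
    then show thesis using that[of y] that[of b] by metis
  qed
  have notin: "x \<notin> A" "y \<notin> A" "z \<notin> A" "x \<notin> B" "y \<notin> B" "z \<notin> B"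
    using A_sub B_sub xyz_notin by auto
  have s_cases: "s = x \<or> s \<in> A" and t_cases: "t = y \<or> t \<in> B" using s t by blast+
  have st: "s \<noteq> t" "z \<noteq> s" "z \<noteq> t" using s_cases t_cases notin xyz A_B_disjoint by auto
  have s_start: "\<exists>a\<in>A. E x a \<and> a \<noteq> w \<and> (s = x \<or> s = a)" if "w \<noteq> s" for w
    using s that by blast
  have t_end: "\<exists>b\<in>B. E b y \<and> b \<noteq> w \<and> (t = y \<or> t = b)" if "w \<noteq> t" for w
    using t that by blast
  obtain a2 where a2: "a2 \<in> A" "E z a2" "a2 \<noteq> s"
  proof -
    have "s \<in> A \<Longrightarrow> \<forall>u\<in>A. E x u \<longrightarrow> u = s" using s notin by blast
    then show thesis using second_entry[of s] st(2) that by blast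
  qed
  obtain b2 where b2: "b2 \<in> B" "E b2 z" "b2 \<noteq> t"
  proof -
    have "t \<in> B \<Longrightarrow> \<forall>u\<in>B. E u y \<longrightarrow> u = t" using t notin by blast
    then show thesis using dual.second_entry[of t] st(3) that by blast
  qed
  define R where "R u v \<longleftrightarrow> E u v \<and> (u = x \<longrightarrow> v \<in> A) \<and> (v = y \<longrightarrow> u \<in> B) \<and> \<not> (u = s \<and> v = t)"
    for u v
  define W where "W = insert z H \<union> {s, t}"
  have R_inside: "connects R (W - {w}) u v"
    if "connects E (H - {w}) u v" "s \<notin> H - {w} \<or> t \<notin> H - {w}" for u v w
    by (rule connects_mono[OF that(1)]) (use that(2) xyz_notin in \<open>auto simp: R_def W_def\<close>)
  have R_start: "connects R (W - {w}) s a" if "a \<in> A" "E x a" "a \<noteq> w" "s = x \<or> s = a" "w \<noteq> s" for a w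
  proof (cases "s = a")
    case True
    then show ?thesis using that connects_refl[of s "W - {w}" R] by (simp add: W_def)
  next
    case False
    then have "R s a" using that t_cases notin A_B_disjoint by (auto simp: R_def)
    then show ?thesis using that A_sub by (intro connects_arc[of R]) (auto simp: W_def)
  qed
  have R_end: "connects R (W - {w}) b t" if "b \<in> B" "E b y" "b \<noteq> w" "t = y \<or> t = b" "w \<noteq> t" for b w
  proof (cases "t = b")
    case True
    then show ?thesis using that connects_refl[of t "W - {w}" R] by (simp add: W_def)
  next
    case False
    then have "R b t" using that s_cases notin A_B_disjoint by (auto simp: R_def)
    then show ?thesis using that B_sub by (intro connects_arc[of R]) (auto simp: W_def)
  qed
  have "\<exists>p. dipath R s p t \<and> set p \<subseteq> W \<and> z \<in> set p"
  proof (rule dipath_through[OF st])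
    show "\<not> R s t" by (simp add: R_def)
    show "R g z \<or> R z g" if g: "R s g" "g \<in> W - {s, z}" for g
    proof -
      have "g \<noteq> x" "g \<noteq> y" "g \<noteq> t"
        using g s_cases t_cases notin xyz A_B_disjoint unfolding R_def W_def H_eq by auto
      moreover have "g \<in> V" using g H_sub calculation by (auto simp: W_def)
      ultimately show ?thesis
        using adj[of g z] alone[of g] g xyz st by (auto simp: R_def)
    qed
    show "connects R (W - {t}) s z"
    proof -
      obtain a where a: "a \<in> A" "E x a" "a \<noteq> t" "s = x \<or> s = a" using s_start st(1) by metis
      have "connects R (W - {t}) s a" using R_start a st(1) by metis
      moreover have "connects R (W - {t}) a b2"
        using R_inside connects_A_B[OF a(1) b2(1)] a(3) b2(3) by auto
      moreover have "R b2 z"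
        using b2 st notin xyz by (auto simp: R_def)
      then have "connects R (W - {t}) b2 z"
        using b2 st B_sub by (intro connects_arc[of R]) (auto simp: W_def)
      ultimately show ?thesis using connects_trans by metis
    qed
    show "connects R (W - {s}) z t"
    proof -
      obtain b where b: "b \<in> B" "E b y" "b \<noteq> s" "t = y \<or> t = b" using t_end st(1) by metis
      have "connects R (W - {s}) b t" using R_end b st(1) by metis
      moreover have "connects R (W - {s}) a2 b"
        using R_inside connects_A_B[OF a2(1) b(1)] b(3) a2(3) by auto
      moreover have "R z a2"
        using a2 st notin xyz by (auto simp: R_def)
      then have "connects R (W - {s}) z a2"
        using a2 st A_sub by (intro connects_arc[of R]) (auto simp: W_def)
      ultimately show ?thesis using connects_trans by metis
    qed
    show "connects R (W - {w}) s t" if w: "w \<in> W - {s, t}" for w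
    proof -
      have ws: "w \<noteq> s" "w \<noteq> t" using w by auto
      obtain a where a: "a \<in> A" "E x a" "a \<noteq> w" "s = x \<or> s = a" using s_start ws(1) by metis
      obtain b where b: "b \<in> B" "E b y" "b \<noteq> w" "t = y \<or> t = b" using t_end ws(2) by metis
      have "connects R (W - {w}) a b"
      proof (cases "s = a \<and> t = b")
        case False
        then have "s \<notin> H \<or> t \<notin> H" using a(4) b(4) xyz_notin by auto
        then show ?thesis using R_inside connects_A_B[OF a(1) b(1)] a(3) b(3) by auto
      next
        case True
        \<comment> \<open>Only here can the removed arc be present in \<open>H\<close>, namely as the arc from \<open>a\<close> to \<open>b\<close>.\<close>
        let ?S = "\<lambda>u v. E u v \<and> \<not> (u = a \<and> v = b)"
        have uniq: "\<And>u. u \<in> A \<Longrightarrow> E x u \<Longrightarrow> u = a" "\<And>u. u \<in> B \<Longrightarrow> E u y \<Longrightarrow> u = b"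
          using s t True a(1) b(1) notin by auto
        have "connects ?S (H - {w}) a b"
        proof (rule ccontr)
          assume cut: "\<not> connects ?S (H - {w}) a b"
          have "\<exists>q. dipath E a q b \<and> set q \<subseteq> V - {x, y} \<and> z \<in> set q"
          proof (cases "w \<in> B")
            case False
            show ?thesis
              by (rule z_path_of_cut_arc[OF a(1,2) uniq(1) b(1) b2(1) _ b2(2) _ False cut])
                (use b2(3) a(3) True in auto)
          next
            case wB: True
            have "\<not> connects (\<lambda>u v. E v u \<and> \<not> (u = b \<and> v = a)) (H - {w}) b a"
            proof
              assume "connects (\<lambda>u v. E v u \<and> \<not> (u = b \<and> v = a)) (H - {w}) b a"
              then have "connects (\<lambda>u v. E u v \<and> \<not> (v = b \<and> u = a)) (H - {w}) a b"
                by (rule iffD2[OF connects_rev])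
              moreover have "(\<lambda>u v. E u v \<and> \<not> (v = b \<and> u = a)) = ?S" by auto
              ultimately show False using cut by simp
            qed
            then have "\<exists>q. dipath (\<lambda>u v. E v u) b q a \<and> set q \<subseteq> V - {y, x} \<and> z \<in> set q"
              by (intro dual.z_path_of_cut_arc[OF b(1,2) uniq(2) a(1) a2(1) _ a2(2)])
                (use a2(3) b(3) True wB A_B_disjoint in auto)
            then obtain q where q: "dipath (\<lambda>u v. E v u) b q a" "set q \<subseteq> V - {y, x}" "z \<in> set q"
              by blast
            have "dipath E a (rev q) b" by (rule iffD2[OF dipath_rev q(1)])
            then show ?thesis using q(2,3) by (intro exI[of _ "rev q"]) auto
          qed
          then show False using none a b by blast
        qed
        then show ?thesis
          by (rule connects_mono) (use True xyz_notin in \<open>auto simp: R_def W_def\<close>)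
      qed
      then show ?thesis
        using R_start[of a w] R_end[of b w] a b ws connects_trans[of R "W - {w}"] by metis
    qed
  qed
  then obtain p where p: "dipath R s p t" "set p \<subseteq> W" "z \<in> set p" by blast
  \<comment> \<open>If the path starts in \<open>x\<close> or ends in \<open>y\<close>, these vertices are cut off.\<close>
  have "\<exists>a q. a \<in> A \<and> E x a \<and> dipath R a q t \<and> set q \<subseteq> W - {x} \<and> z \<in> set q"
  proof (cases "s = x")
    case True
    obtain a q where q: "p = s # q" "R s a" "dipath R a q t" "s \<notin> set q"
      using dipath_tl[OF p(1) st(1)] by metis
    moreover have "a \<in> A" "E x a" using q(2) True by (auto simp: R_def)
    ultimately show ?thesis using p(2,3) True st(2)
      by (intro exI[of _ a] exI[of _ q]) auto
  next
    case False
    moreover have "x \<notin> W" using False t_cases xyz xyz_notin notin by (auto simp: W_def)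
    ultimately show ?thesis using s p
      by (intro exI[of _ s] exI[of _ p]) auto
  qed
  then obtain a q where q: "a \<in> A" "E x a" "dipath R a q t" "set q \<subseteq> W - {x}" "z \<in> set q"
    by blast
  have "\<exists>b r. b \<in> B \<and> E b y \<and> dipath R a r b \<and> set r \<subseteq> W - {x, y} \<and> z \<in> set r"
  proof (cases "t = y")
    case True
    have "a \<noteq> t" using q(1) True notin by auto
    then obtain b r where r: "q = r @ [t]" "R b t" "dipath R a r b" "t \<notin> set r"
      using dipath_butlast[OF q(3)] by metis
    moreover have "b \<in> B" "E b y" using r(2) True by (auto simp: R_def)
    ultimately show ?thesis using q(4,5) True st(3)
      by (intro exI[of _ b] exI[of _ r]) auto
  next
    case False
    moreover have "y \<notin> W" using False s_cases xyz xyz_notin notin by (auto simp: W_def)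
    ultimately show ?thesis using t q
      by (intro exI[of _ t] exI[of _ q]) auto
  qed
  then obtain b r where r: "b \<in> B" "E b y" "dipath R a r b" "set r \<subseteq> W - {x, y}" "z \<in> set r"
    by blast
  have "dipath E a r b" by (rule dipath_mono[OF r(3)]) (simp add: R_def)
  moreover have "W \<subseteq> V" using H_sub xyz s_cases t_cases A_sub B_sub by (auto simp: W_def)
  ultimately show False using none q(1,2) r by blast
qed

lemma spanning_from_ends: "\<exists>p. dipath E x p y \<and> col ` V \<subseteq> col ` set p"
proof (cases "\<exists>u\<in>V - {z}. col u = col z")
  case True
  obtain a where a: "a \<in> A" "E x a" using entered_from(1)[OF source] by blast
  obtain b where b: "b \<in> B" "E b y" using dual.entered_from(1)[OF sink] by blast
  have "connects E (H - {x}) a b"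
    by (rule connects_A_B[OF a(1) b(1)]) (use a b A_sub B_sub xyz_notin in auto)
  then obtain q where "dipath E a q b" "set q \<subseteq> H - {x}" by (rule connectsE)
  moreover have "H - {x} \<subseteq> V - {x, y}" using H_eq by blast
  ultimately show ?thesis using spanning_from_end_path[OF a(1) b(1) a(2) b(2), of q] True by blast
next
  case False
  then have "\<And>u. u \<in> V \<Longrightarrow> u \<noteq> z \<Longrightarrow> col u \<noteq> col z" by blast
  then show ?thesis using end_path_through_z spanning_from_end_path by blast
qed

end

lemma (in nonstrong_deletion) spanning_path: "\<exists>p. dipath E x p y \<and> col ` V \<subseteq> col ` set p"
proof -
  interpret dual: nonstrong_deletion V "\<lambda>u v. E v u" col y x z H by (rule dual)
  have fin: "finite H" "H \<noteq> {}" using finV H_eq not_strong by auto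
  obtain A where A: "source_comp E H A" using source_comp_exists[OF fin] by blast
  obtain B where B: "source_comp (\<lambda>u v. E v u) H B" using source_comp_exists[OF fin] by blast
  show ?thesis
  proof (cases "(\<exists>a. A = {a}) \<or> (\<exists>b. B = {b})")
    case True
    then show ?thesis
    proof
      assume "\<exists>a. A = {a}"
      then show ?thesis using A spanning_from_singleton_source by blast
    next
      assume "\<exists>b. B = {b}"
      then obtain p where p: "dipath (\<lambda>u v. E v u) y p x" "col ` V \<subseteq> col ` set p"
        using B dual.spanning_from_singleton_source by blast
      have "dipath E x (rev p) y" by (rule iffD2[OF dipath_rev p(1)])
      then show ?thesis using p(2) by (metis set_rev)
    qed
  next
    case False
    interpret nontrivial_ends V E col x y z H A B
      by unfold_locales (use A B False in auto)
    show ?thesis by (rule spanning_from_ends)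
  qed
qed

section \<open>Quasi-Hamiltonian paths\<close>

lemma vpath_iff_dipath:
  "vpath p G \<and> hd p = u \<and> last p = v \<longleftrightarrow>
    dipath (\<lambda>u v. u \<rightarrow>\<^bsub>G\<^esub> v) u p v \<and> set p \<subseteq> verts G"
proof -
  have "set (vwalk_arcs p) \<subseteq> S \<longleftrightarrow> successively (\<lambda>u v. (u, v) \<in> S) p" for S
    by (induction p rule: vwalk_arcs.induct) auto
  then show ?thesis unfolding vpath_def vwalk_def dipath_def by auto
qed

lemma dipath_closed:
  assumes "dipath R u p v" "u \<in> W" "\<And>a b. R a b \<Longrightarrow> b \<in> W"
  shows "set p \<subseteq> W"
proof -
  have "successively R p \<Longrightarrow> set (tl p) \<subseteq> W"
    using assms(3) by (induction R p rule: successively.induct) auto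
  then show ?thesis using assms(1,2) unfolding dipath_def by (cases p) auto
qed

lemma strongly_connected_iff_connects:
  assumes "wf_digraph D" "W \<subseteq> verts D"
  shows "strongly_connected (D \<restriction> W) \<longleftrightarrow>
    W \<noteq> {} \<and> (\<forall>u\<in>W. \<forall>v\<in>W. connects (\<lambda>u v. u \<rightarrow>\<^bsub>D\<^esub> v) W u v)"
proof -
  interpret wf_digraph D by fact
  have dom: "u \<rightarrow>\<^bsub>D \<restriction> W\<^esub> v \<longleftrightarrow> u \<rightarrow>\<^bsub>D\<^esub> v" if "u \<in> W" "v \<in> W" for u v
    using that unfolding arcs_ends_def arc_to_ends_def by auto
  have "(\<exists>p. vpath p (D \<restriction> W) \<and> hd p = u \<and> last p = v) \<longleftrightarrow>
      connects (\<lambda>u v. u \<rightarrow>\<^bsub>D\<^esub> v) W u v" for u v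
  proof -
    have "dipath (\<lambda>u v. u \<rightarrow>\<^bsub>D \<restriction> W\<^esub> v) u p v \<longleftrightarrow> dipath (\<lambda>u v. u \<rightarrow>\<^bsub>D\<^esub> v) u p v"
      if "set p \<subseteq> W" for p
      using that by (intro iffI; elim dipath_mono) (auto simp: dom subset_iff)
    then show ?thesis unfolding vpath_iff_dipath connects_def by auto
  qed
  moreover have "wf_digraph (D \<restriction> W)"
    by (rule wellformed_induce_subgraph)
  moreover have "connects (\<lambda>u v. u \<rightarrow>\<^bsub>D\<^esub> v) W u u" if "u \<in> W" for u
    using that by (rule connects_refl)
  ultimately show ?thesis
    unfolding strongly_connected_iff_vpath[OF \<open>wf_digraph (D \<restriction> W)\<close>] by auto metis
qed

lemma chromatic_number_le_3:
  assumes "\<And>u v. u \<rightarrow>\<^bsub>D\<^esub> v \<Longrightarrow> c u \<noteq> c v" "\<And>v. v \<in> verts D \<Longrightarrow> c v \<in> {k1, k2, k3}"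
    and "wf_digraph D"
  shows "chromatic_number D \<le> 3"
proof -
  interpret wf_digraph D by fact
  define f :: "'a \<Rightarrow> nat" where "f v = (if c v = k1 then 0 else if c v = k2 then 1 else 2)" for v
  have f_inj: "c u = c v" if "f u = f v" "u \<in> verts D" "v \<in> verts D" for u v
    using that assms(2)[of u] assms(2)[of v] unfolding f_def by (auto split: if_splits)
  have "colorable D 3"
    unfolding colorable_def
  proof (intro exI[of _ f] conjI ballI)
    show "f v < 3" if "v \<in> verts D" for v by (simp add: f_def)
    show "case e of (u, v) \<Rightarrow> f u \<noteq> f v" if e: "e \<in> parcs (mk_symmetric D)" for e
    proof -
      obtain u v where uv: "e = (u, v)" by (cases e)
      have "u \<rightarrow>\<^bsub>D\<^esub> v \<or> v \<rightarrow>\<^bsub>D\<^esub> u"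
        using e uv by (auto simp: parcs_mk_symmetric in_arcs_imp_in_arcs_ends)
      then have "c u \<noteq> c v" "u \<in> verts D" "v \<in> verts D" 
        using assms(1)[of u v] assms(1)[of v u] adj_in_verts[of u v] adj_in_verts[of v u] by auto
      then show ?thesis using f_inj[of u v] uv by auto
    qed
  qed
  then show ?thesis unfolding chromatic_number_def by (rule Least_le)
qed

text \<open>
  The case \<open>w = x\<close>, in which only one vertex is deleted, is included.
\<close>

lemma k_strong_2_delete:
  assumes "wf_digraph D" "k_strong 2 (del_verts D {x})" "u \<in> verts D - {x, w}" "v \<in> verts D - {x, w}"
  shows "connects (\<lambda>u v. u \<rightarrow>\<^bsub>D\<^esub> v) (verts D - {x, w}) u v"
proof -
  have "card ({w} \<inter> (verts D - {x})) \<le> 1"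
    using card_mono[of "{w}" "{w} \<inter> (verts D - {x})"] by simp
  then have "strongly_connected (del_verts (del_verts D {x}) ({w} \<inter> (verts D - {x})))"
    using assms(2) unfolding k_strong_def by simp
  moreover have "del_verts (del_verts D {x}) ({w} \<inter> (verts D - {x})) = D \<restriction> (verts D - {x, w})"
    unfolding induce_subgraph_def by auto
  ultimately show ?thesis
    using strongly_connected_iff_connects[OF assms(1), of "verts D - {x, w}"] assms(3,4) by auto
qed

theorem theorem2:
  fixes D :: "('a,'b) pre_digraph" and \<C> :: "'a set set" and x y z :: 'a
  assumes "semicomplete_multipartite D \<C>"
    and "k_strong 2 D"
    and "x \<in> verts D" "y \<in> verts D" "z \<in> verts D"
    and "x \<noteq> y" "x \<noteq> z" "y \<noteq> z"
    and "\<not> in_2cycle D x" "\<not> in_2cycle D y"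
    and "k_strong 2 (del_verts D {x})" "k_strong 2 (del_verts D {y})"
    and "\<not> strongly_connected (del_verts D {x, y, z})"
    and "chromatic_number (del_verts D {x, y, z}) \<ge> 4"
  shows "\<exists>p. quasi_hamiltonian_path D \<C> x p y"
proof -
  interpret D: semicomplete_multipartite D \<C> by fact
  let ?E = "\<lambda>u v. u \<rightarrow>\<^bsub>D\<^esub> v" and ?H = "verts D - {x, y, z}"
  define col where "col v = {C \<in> \<C>. v \<in> C}" for v
  have one_class: "\<exists>!C. C \<in> \<C> \<and> v \<in> C" if v: "v \<in> verts D" for v
  proof -
    obtain C where C: "C \<in> \<C>" "v \<in> C" using v partition_onD1[OF D.partition] by auto
    moreover have "C' = C" if "C' \<in> \<C>" "v \<in> C'" for C'
      using disjointD[OF partition_onD2[OF D.partition] that(1) C(1)] that(2) C(2) by auto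
    ultimately show ?thesis by blast
  qed
  have col_eq: "col u = col v \<longleftrightarrow> (\<exists>C\<in>\<C>. u \<in> C \<and> v \<in> C)" if "u \<in> verts D" "v \<in> verts D" for u v
    using one_class[OF that(1)] one_class[OF that(2)] unfolding col_def by auto
  have adj: "u \<rightarrow>\<^bsub>D\<^esub> v \<or> v \<rightarrow>\<^bsub>D\<^esub> u \<longleftrightarrow> col u \<noteq> col v" if "u \<in> verts D" "v \<in> verts D" for u v
    using D.adjacent_iff[of u v] col_eq[of u v] that D.adj_not_same by (cases "u = v") auto
  have colours: "\<exists>h\<in>?H. col h \<notin> {k1, k2, k3}" for k1 k2 k3
  proof (rule ccontr)
    assume few: "\<not> ?thesis"
    have "chromatic_number (D \<restriction> ?H) \<le> 3"
    proof (rule chromatic_number_le_3)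
      show "wf_digraph (D \<restriction> ?H)" by (rule D.wellformed_induce_subgraph)
      show "col v \<in> {k1, k2, k3}" if "v \<in> verts (D \<restriction> ?H)" for v
        using few that by auto
      show "col u \<noteq> col v" if "u \<rightarrow>\<^bsub>D \<restriction> ?H\<^esub> v" for u v
        using adj[of u v] dominates_induce_subgraphD[OF that] D.adj_in_verts[of u v] by auto
    qed
    then show False using assms(14) by simp
  qed
  have twocycle: "\<not> v \<rightarrow>\<^bsub>D\<^esub> u" if "u \<rightarrow>\<^bsub>D\<^esub> v" "\<not> in_2cycle D u" for u v
    using that D.adj_not_same[of u] unfolding in_2cycle_def by (cases "v = u") auto
  interpret nonstrong_deletion "verts D" ?E col x y z ?H
  proof
    show "\<exists>u\<in>?H. \<exists>v\<in>?H. \<not> connects ?E ?H u v"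
      using assms(13) strongly_connected_iff_connects[OF D.wf_digraph, of ?H] colours by blast
  qed (use assms adj colours twocycle k_strong_2_delete[OF D.wf_digraph] in auto)
  obtain p where p: "dipath ?E x p y" "col ` verts D \<subseteq> col ` set p" using spanning_path by blast
  have "set p \<subseteq> verts D"
    by (rule dipath_closed[OF p(1)]) (use assms(3) D.adj_in_verts in auto)
  moreover have "set p \<inter> C \<noteq> {}" if C: "C \<in> \<C>" for C
  proof -
    obtain v where v: "v \<in> C" using C partition_onD3[OF D.partition] by (metis ex_in_conv)
    then have "v \<in> verts D" using C partition_onD1[OF D.partition] by auto
    then obtain u where u: "u \<in> set p" "col v = col u" using p(2) by blast
    have "C \<in> col v" using C v by (simp add: col_def)
    then show ?thesis using u by (auto simp: col_def)
  qed
  ultimately have "quasi_hamiltonian_path D \<C> x p y"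
    using p(1) vpath_iff_dipath[of p D x y] unfolding quasi_hamiltonian_path_def by blast
  then show ?thesis ..
qed

end
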